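(* Let $D$ be a weakly locally finite division ring with center $F$, let $n\ge2$, and let $N$ be an infinite subnormal subgroup of $\mathrm{GL}_n(D)$. If $N$ is finitely generated, then $N\subseteq F^*I=\{\alpha I\mid \alpha\in F^*\}$, where $I$ is the identity matrix.
   Context: A division ring $D$ is weakly locally finite if for every finite subset $S\subseteq D$, the division subring generated by $S$ is finite dimensional over its own center. *)

theory Defs
  imports "HOL-Analysis.Analysis" "HOL-Algebra.Algebra"
begin

text \<open>Division subrings of a division ring, as subsets.\<close>
definition division_subring :: "'a::division_ring set \<Rightarrow> bool" where
  "division_subring K \<longleftrightarrow> 0 \<in> K \<and> 1 \<in> K \<and>
     (\<forall>x\<in>K. \<forall>y\<in>K. x + y \<in> K \<and> x * y \<in> K) \<and>
     (\<forall>x\<in>K. - x \<in> K) \<and> (\<forall>x\<in>K. x \<noteq> 0 \<longrightarrow> inverse x \<in> K)"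

text \<open>The division subring generated by a subset S.\<close>
definition gen_division_subring :: "'a::division_ring set \<Rightarrow> 'a set" where
  "gen_division_subring S = \<Inter>{K. division_subring K \<and> S \<subseteq> K}"

text \<open>Center of a subset K (elements of K commuting with all of K).\<close>
definition center_of :: "'a::division_ring set \<Rightarrow> 'a set" where
  "center_of K = {z \<in> K. \<forall>x\<in>K. z * x = x * z}"

text \<open>K is finite dimensional over the subfield Z \<subseteq> K: K has a finite spanning
  set as a (left) Z-vector space.\<close>
definition fin_dim_over :: "'a::division_ring set \<Rightarrow> 'a set \<Rightarrow> bool" where
  "fin_dim_over K Z \<longleftrightarrow> (\<exists>B. finite B \<and> B \<subseteq> K \<and>
     K = {\<Sum>b\<in>B. c b * b | c. \<forall>b\<in>B. c b \<in> Z})"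

definition weakly_locally_finite :: "'a::division_ring itself \<Rightarrow> bool" where
  "weakly_locally_finite _ \<longleftrightarrow> (\<forall>S::'a set. finite S \<longrightarrow>
     fin_dim_over (gen_division_subring S) (center_of (gen_division_subring S)))"

text \<open>The general linear group GL_n(D), n = CARD('n).\<close>
definition GL :: "('a::division_ring ^'n^'n) monoid" where
  "GL = \<lparr>carrier = {A. invertible A}, mult = (**), one = mat 1\<rparr>"

text \<open>Subnormal subgroups: there is a finite chain
  N = N_0 \<lhd> N_1 \<lhd> ... \<lhd> N_k = carrier G.\<close>
inductive subnormal :: "('a, 'b) monoid_scheme \<Rightarrow> 'a set \<Rightarrow> bool" for G where
  top: "subnormal G (carrier G)"
| step: "subnormal G K \<Longrightarrow> H \<lhd> (G\<lparr>carrier := K\<rparr>) \<Longrightarrow> subnormal G H"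

end

theory Submission
  imports Defs
begin

text \<open>
  Iwasawa's argument shows that a subgroup \<open>H\<close> of \<open>GL\<^sub>n(D)\<close>, \<open>D\<close> infinite, which is not central and is
  normal in a group \<open>K\<close> containing all elementary matrices, contains all elementary matrices itself:
  \<open>K\<close> is doubly transitive on lines, so \<open>H\<close> is transitive on lines, hence every elementary matrix lies
  in \<open>H A\<close>, where \<open>A\<close> is the abelian group of transvections along one fixed line; therefore
  commutators of products of elementary matrices lie in \<open>H\<close>. By induction along the subnormal series a
  noncentral subnormal \<open>N\<close> contains all elementary matrices. If \<open>N\<close> is finitely generated, then \<open>D\<close> is
  finitely generated as a ring, hence, being weakly locally finite, finite dimensional over its center
  \<open>F\<close>. By Artin--Tate \<open>F\<close> is a finitely generated ring, and by Zariski's lemma over the integers a field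
  that is finitely generated as a ring is finite. So \<open>D\<close> and \<open>N\<close> are finite.
\<close>

section \<open>Subrings, spans and the Artin--Tate lemma\<close>

definition subring_set :: "'a::ring_1 set \<Rightarrow> bool" where
  "subring_set K \<longleftrightarrow> 1 \<in> K \<and> (\<forall>x\<in>K. \<forall>y\<in>K. x - y \<in> K \<and> x * y \<in> K)"

lemma subring_setD:
  assumes "subring_set K"
  shows "1 \<in> K" "0 \<in> K" "x \<in> K \<Longrightarrow> y \<in> K \<Longrightarrow> x - y \<in> K" "x \<in> K \<Longrightarrow> y \<in> K \<Longrightarrow> x * y \<in> K"
    "x \<in> K \<Longrightarrow> - x \<in> K" "x \<in> K \<Longrightarrow> y \<in> K \<Longrightarrow> x + y \<in> K" "x \<in> K \<Longrightarrow> x ^ n \<in> K"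
proof -
  show 1: "1 \<in> K" and d: "\<And>x y. x \<in> K \<Longrightarrow> y \<in> K \<Longrightarrow> x - y \<in> K"
    and m: "\<And>x y. x \<in> K \<Longrightarrow> y \<in> K \<Longrightarrow> x * y \<in> K"
    using assms by (auto simp: subring_set_def)
  show z: "0 \<in> K" using d[OF 1 1] by simp
  show n: "\<And>x. x \<in> K \<Longrightarrow> - x \<in> K" using d[OF z] by simp
  show "\<And>x y. x \<in> K \<Longrightarrow> y \<in> K \<Longrightarrow> x + y \<in> K" using d n by fastforce
  show "x \<in> K \<Longrightarrow> x ^ n \<in> K" by (induction n) (auto intro: 1 m)
qed

text \<open>Generated inductively so that facts about all elements, such as clearing denominators,
  follow by rule induction; \<open>subring_gen_least\<close> gives minimality.\<close>

inductive_set subring_gen :: "'a::ring_1 set \<Rightarrow> 'a set" for S where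
  base: "x \<in> S \<Longrightarrow> x \<in> subring_gen S"
| one: "1 \<in> subring_gen S"
| diff: "x \<in> subring_gen S \<Longrightarrow> y \<in> subring_gen S \<Longrightarrow> x - y \<in> subring_gen S"
| mult: "x \<in> subring_gen S \<Longrightarrow> y \<in> subring_gen S \<Longrightarrow> x * y \<in> subring_gen S"

lemma subring_set_subring_gen: "subring_set (subring_gen S)"
  by (auto simp: subring_set_def intro: subring_gen.intros)

lemma subring_gen_least:
  assumes "subring_set K" "S \<subseteq> K"
  shows "subring_gen S \<subseteq> K"
proof
  fix x assume "x \<in> subring_gen S"
  then show "x \<in> K"
    by induction (use assms subring_setD[OF assms(1)] in blast)+
qed

lemma subring_gen_superset: "S \<subseteq> subring_gen S"
  by (auto intro: subring_gen.base)

lemma subring_gen_subring_set: "subring_set K \<Longrightarrow> subring_gen K = K"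
  using subring_gen_least[of K K] subring_gen_superset[of K] by auto

lemma division_subring_subring_set: "division_subring K \<Longrightarrow> subring_set K"
proof -
  assume K: "division_subring K"
  have "x - y \<in> K" if "x \<in> K" "y \<in> K" for x y
  proof -
    have "x + (- y) \<in> K" using K that unfolding division_subring_def by blast
    then show ?thesis by simp
  qed
  then show ?thesis using K by (auto simp: subring_set_def division_subring_def)
qed

section \<open>Spans with coefficients on the left\<close>

inductive_set lspan :: "'a::ring_1 set \<Rightarrow> 'a set \<Rightarrow> 'a set" for L B where
  zero: "0 \<in> lspan L B"
| add: "c \<in> L \<Longrightarrow> b \<in> B \<Longrightarrow> y \<in> lspan L B \<Longrightarrow> c * b + y \<in> lspan L B"

lemma lspan_add: "x \<in> lspan L B \<Longrightarrow> y \<in> lspan L B \<Longrightarrow> x + y \<in> lspan L B"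
  by (induction rule: lspan.induct) (auto simp: add.assoc intro: lspan.add)

lemma lspan_scale:
  assumes "subring_set L" "x \<in> lspan L B" "a \<in> L"
  shows "a * x \<in> lspan L B"
  using assms(2)
proof induction
  case (add c b y)
  have "a * (c * b + y) = (a * c) * b + a * y" by (simp add: algebra_simps)
  then show ?case using add assms by (metis lspan.add subring_setD(4))
qed (simp add: lspan.zero)

lemma lspan_scaled_base: "c \<in> L \<Longrightarrow> b \<in> B \<Longrightarrow> c * b \<in> lspan L B"
  using lspan.add[OF _ _ lspan.zero, of c L b B] by simp

lemma lspan_base: "subring_set L \<Longrightarrow> b \<in> B \<Longrightarrow> b \<in> lspan L B"
  using lspan_scaled_base[of 1 L b B] by (simp add: subring_setD(1))

lemma lspan_uminus: "subring_set L \<Longrightarrow> x \<in> lspan L B \<Longrightarrow> - x \<in> lspan L B"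
  using lspan_scale[of L x B "- 1"] by (simp add: subring_setD(1,5))

lemma lspan_least:
  assumes "subring_set L" "B \<subseteq> lspan L C"
  shows "lspan L B \<subseteq> lspan L C"
proof
  fix x assume "x \<in> lspan L B"
  then show "x \<in> lspan L C"
  proof induction
    case (add c b y)
    then show ?case using lspan_add lspan_scale[OF assms(1)] assms(2) by (metis subsetD)
  qed (rule lspan.zero)
qed

lemma lspan_sum:
  assumes "finite B" "\<And>b. b \<in> B \<Longrightarrow> c b \<in> L" "B \<subseteq> C"
  shows "(\<Sum>b\<in>B. c b * b) \<in> lspan L C"
  using assms by (induction B rule: finite_induct) (auto intro: lspan.intros)

text \<open>Translates the inductive span back into sums indexed by \<open>B\<close>, the form used
  in \<open>fin_dim_over\<close>; coefficients of a repeated element are added up.\<close>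

lemma lspan_imp_sum:
  assumes "finite B" "subring_set L" "x \<in> lspan L B"
  shows "\<exists>c. (\<forall>b\<in>B. c b \<in> L) \<and> x = (\<Sum>b\<in>B. c b * b)"
  using assms(3)
proof induction
  case zero
  show ?case using subring_setD(2)[OF assms(2)] by (intro exI[of _ "\<lambda>_. 0"]) auto
next
  case (add a b y)
  then obtain c where c: "\<forall>b\<in>B. c b \<in> L" "y = (\<Sum>b\<in>B. c b * b)" by auto
  have "a * b = (\<Sum>b'\<in>B. (if b' = b then a else 0) * b')"
  proof -
    have "(\<Sum>b'\<in>B. (if b' = b then a else 0) * b') = (\<Sum>b'\<in>B. if b' = b then a * b else 0)"
      by (intro sum.cong) auto
    then show ?thesis using assms(1) add.hyps(2) by simp
  qed
  then have s: "a * b + y = (\<Sum>b'\<in>B. ((if b' = b then a else 0) + c b') * b')"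
    using c by (simp add: sum.distrib distrib_right)
  have "\<forall>b'\<in>B. (if b' = b then a else 0) + c b' \<in> L"
    using c(1) add.hyps(1) subring_setD(2)[OF assms(2)]
    by (intro ballI subring_setD(6)[OF assms(2)]) auto
  with s show ?case
    by (intro exI[of _ "\<lambda>b'. (if b' = b then a else 0) + c b'"] conjI)
qed

lemma fin_dim_over_UNIV_iff:
  assumes "subring_set L"
  shows "fin_dim_over UNIV L \<longleftrightarrow> (\<exists>B. finite B \<and> lspan L B = UNIV)"
proof
  assume "fin_dim_over UNIV L"
  then obtain B where B: "finite B" "UNIV = {\<Sum>b\<in>B. c b * b | c. \<forall>b\<in>B. c b \<in> L}"
    unfolding fin_dim_over_def by blast
  have "x \<in> lspan L B" for x
  proof -
    obtain c where "x = (\<Sum>b\<in>B. c b * b)" "\<forall>b\<in>B. c b \<in> L"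
      using B(2) by blast
    then show ?thesis using lspan_sum[OF B(1)] by auto
  qed
  then show "\<exists>B. finite B \<and> lspan L B = UNIV" using B(1) by blast
next
  assume "\<exists>B. finite B \<and> lspan L B = UNIV"
  then obtain B where B: "finite B" "lspan L B = UNIV" by auto
  show "fin_dim_over UNIV L"
    unfolding fin_dim_over_def
  proof (intro exI[of _ B] conjI)
    show "UNIV = {\<Sum>b\<in>B. c b * b | c. \<forall>b\<in>B. c b \<in> L}"
    proof (rule Set.set_eqI)
      fix x
      have "x \<in> lspan L B" using B(2) by simp
      from lspan_imp_sum[OF B(1) assms this]
      show "x \<in> UNIV \<longleftrightarrow> x \<in> {\<Sum>b\<in>B. c b * b | c. \<forall>b\<in>B. c b \<in> L}" by auto
    qed
  qed (use B in auto)
qed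

text \<open>A substitute for completing 1 to a basis: the only independence that
  \<open>Artin_Tate\<close> uses is that an element of \<open>L\<close> equals its own coefficient
  at 1.\<close>

lemma exists_span_separating_one:
  fixes L :: "'a::division_ring set"
  assumes L: "division_subring L" and fd: "fin_dim_over UNIV L"
  obtains B where "finite B" "1 \<in> B" "lspan L B = UNIV"
    "\<forall>a l. (\<forall>b\<in>B. a b \<in> L) \<longrightarrow> l \<in> L \<longrightarrow> l = (\<Sum>b\<in>B. a b * b) \<longrightarrow> l = a 1"
proof -
  note Ls = division_subring_subring_set[OF L]
  \<comment> \<open>A spanning set of least cardinality among those containing 1 will do.\<close>
  let ?P = "\<lambda>B. finite B \<and> 1 \<in> B \<and> lspan L B = UNIV"
  obtain B0 where B0: "finite B0" "lspan L B0 = UNIV"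
    using fd fin_dim_over_UNIV_iff[OF Ls] by auto
  have "lspan L B0 \<subseteq> lspan L (insert 1 B0)"
    by (rule lspan_least[OF Ls]) (auto intro: lspan_base[OF Ls])
  then have "?P (insert 1 B0)" using B0 by auto
  then have "\<exists>B. ?P B \<and> (\<forall>C. ?P C \<longrightarrow> card B \<le> card C)" by (rule ex_has_least_nat)
  then obtain B where B: "?P B" and min: "\<And>C. ?P C \<Longrightarrow> card B \<le> card C" by blast
  \<comment> \<open>A relation with a nonzero coefficient at \<open>b0\<close> would express
    \<open>b0\<close> by the others, and \<open>B - {b0}\<close> would be a smaller spanning set
    still containing 1.\<close>
  have zero: "a b0 = 0"
    if a: "\<forall>b\<in>B. a b \<in> L" and s: "(\<Sum>b\<in>B. a b * b) = 0" and b0: "b0 \<in> B" "b0 \<noteq> 1" for a b0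
  proof (rule ccontr)
    assume nz: "a b0 \<noteq> 0"
    let ?i = "inverse (a b0)"
    have iL: "?i \<in> L" using L a b0 nz by (auto simp: division_subring_def)
    have "a b0 * b0 + (\<Sum>b\<in>B - {b0}. a b * b) = 0"
      using s B b0 by (simp add: sum.remove)
    then have "a b0 * b0 = - (\<Sum>b\<in>B - {b0}. a b * b)"
      by (simp add: eq_neg_iff_add_eq_0)
    then have "?i * (a b0 * b0) = ?i * (- (\<Sum>b\<in>B - {b0}. a b * b))" by simp
    then have "b0 = - ?i * (\<Sum>b\<in>B - {b0}. a b * b)"
      using nz by (simp add: mult.assoc[symmetric])
    moreover have "(\<Sum>b\<in>B - {b0}. a b * b) \<in> lspan L (B - {b0})"
      using B a by (intro lspan_sum) auto
    ultimately have "b0 \<in> lspan L (B - {b0})"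
      using lspan_scale[OF Ls] subring_setD(5)[OF Ls iL] by metis
    then have "B \<subseteq> lspan L (B - {b0})"
      using lspan_base[OF Ls, of _ "B - {b0}"] by blast
    then have "lspan L (B - {b0}) = UNIV" using lspan_least[OF Ls, of B "B - {b0}"] B by auto
    then have "card B \<le> card (B - {b0})" using B b0 by (intro min) auto
    moreover have "card (B - {b0}) < card B" using B b0 by (intro card_Diff1_less) auto
    ultimately show False by simp
  qed
  have "l = a 1" if a: "\<forall>b\<in>B. a b \<in> L" and l: "l \<in> L" "l = (\<Sum>b\<in>B. a b * b)" for a l
  proof -
    \<comment> \<open>Subtracting \<open>l\<close> from the coefficient at 1 turns the equation into
      a relation, so all other coefficients vanish.\<close>
    let ?a = "a(1 := a 1 - l)"
    have "(\<Sum>b\<in>B. a b * b) = a 1 + (\<Sum>b\<in>B - {1}. a b * b)"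
      using B sum.remove[of B 1 "\<lambda>b. a b * b"] by simp
    moreover have "(\<Sum>b\<in>B. ?a b * b) = (a 1 - l) + (\<Sum>b\<in>B - {1}. a b * b)"
      using B sum.remove[of B 1 "\<lambda>b. ?a b * b"] by simp
    ultimately have "(\<Sum>b\<in>B. ?a b * b) = 0" using l by simp
    moreover have "\<forall>b\<in>B. ?a b \<in> L" using a l B subring_setD(3)[OF Ls] by simp
    ultimately have "a b = 0" if "b \<in> B" "b \<noteq> 1" for b
      using zero[of ?a b] that by simp
    then have "(\<Sum>b\<in>B - {1}. a b * b) = 0" by (intro sum.neutral) auto
    then show ?thesis using l B sum.remove[of B 1 "\<lambda>b. a b * b"] by simp
  qed
  then show ?thesis using that B by blast
qed

text \<open>A noncommutative ambient ring is allowed so that the lemma serves both fields of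
  fractions and, with \<open>R = {}\<close>, the center of \<open>D\<close>. Reading off the
  coefficient at 1 takes the place of the usual Noetherian argument.\<close>

lemma Artin_Tate:
  fixes L :: "'a::division_ring set"
  assumes L: "division_subring L" and central: "\<And>l y. l \<in> L \<Longrightarrow> l * y = y * l"
    and fd: "fin_dim_over UNIV L"
    and R: "R \<subseteq> L" and S: "finite S" and gen: "subring_gen (R \<union> S) = UNIV"
  obtains C where "finite C" "C \<subseteq> L" "L = subring_gen (R \<union> C)"
proof -
  note Ls = division_subring_subring_set[OF L]
  obtain B where B: "finite B" "1 \<in> B" "lspan L B = UNIV"
    and uniq: "\<forall>a l. (\<forall>b\<in>B. a b \<in> L) \<longrightarrow> l \<in> L \<longrightarrow> l = (\<Sum>b\<in>B. a b * b) \<longrightarrow> l = a 1"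
    by (rule exists_span_separating_one[OF L fd])
  have "\<forall>y. \<exists>c. (\<forall>b\<in>B. c b \<in> L) \<and> y = (\<Sum>b\<in>B. c b * b)"
    using lspan_imp_sum[OF B(1) Ls] B(3) by simp
  then obtain c where "\<forall>y. (\<forall>b\<in>B. c y b \<in> L) \<and> y = (\<Sum>b\<in>B. c y b * b)"
    unfolding choice_iff by blast
  then have c: "\<And>y b. b \<in> B \<Longrightarrow> c y b \<in> L" "\<And>y. (\<Sum>b\<in>B. c y b * b) = y" by auto
  \<comment> \<open>The products of two elements of \<open>B\<close> join \<open>S\<close>, since
    their coordinates make the span of \<open>B\<close> closed under multiplication.\<close>
  define Y where "Y = S \<union> (\<lambda>(b, b'). b * b') ` (B \<times> B)"
  define C where "C = (\<lambda>(y, b). c y b) ` (Y \<times> B)"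
  \<comment> \<open>The structure constants of \<open>B\<close> and the coordinates of \<open>S\<close> lie in \<open>A\<close>, so the \<open>A\<close>-span of \<open>B\<close> is a
    ring and hence everything; an element of \<open>L\<close> is then equal to its coefficient at 1.\<close>
  define A where "A = subring_gen (R \<union> C)"
  have finC: "finite C" using S B by (auto simp: C_def Y_def)
  have CL: "C \<subseteq> L" using c(1) by (auto simp: C_def)
  have As: "subring_set A" unfolding A_def by (rule subring_set_subring_gen)
  have AL: "A \<subseteq> L" unfolding A_def using subring_gen_least[OF Ls] R CL by auto
  have Y: "y \<in> lspan A B" if "y \<in> Y" for y
  proof -
    have "(\<Sum>b\<in>B. c y b * b) \<in> lspan A B"
      using B(1) that
      by (intro lspan_sum) (force simp: A_def C_def intro: subring_gen.base)+
    then show ?thesis by (simp only: c(2))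
  qed
  have bm: "b * m \<in> lspan A B" if m: "m \<in> lspan A B" and b: "b \<in> B" for b m
    using m
  proof induction
    case (add a b' y)
    \<comment> \<open>Centrality of \<open>L\<close> enters here: the scalar \<open>a\<close> has to
      move past \<open>b\<close>.\<close>
    have "b * a = a * b" using central[of a b] add.hyps(1) AL by auto
    then have "b * (a * b' + y) = a * (b * b') + b * y"
      by (simp add: distrib_left mult.assoc[symmetric])
    moreover have "b * b' \<in> lspan A B" using b add.hyps by (intro Y) (auto simp: Y_def)
    ultimately show ?case
      using add by (simp add: lspan_add lspan_scale[OF As])
  qed (simp add: lspan.zero)
  have mm: "m * m' \<in> lspan A B" if "m \<in> lspan A B" "m' \<in> lspan A B" for m m'
    using that(1)
  proof induction
    case (add a b y)
    have "(a * b + y) * m' = a * (b * m') + y * m'" by (simp add: algebra_simps)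
    then show ?case
      using lspan_scale[OF As bm[OF that(2) add.hyps(2)] add.hyps(1)] add.IH
      by (simp add: lspan_add)
  qed (simp add: lspan.zero)
  have "subring_set (lspan A B)"
    unfolding subring_set_def
    using mm lspan_base[OF As B(2)] lspan_add[OF _ lspan_uminus[OF As]] by auto
  moreover have "R \<subseteq> lspan A B"
  proof
    fix r assume "r \<in> R"
    then have "r \<in> A" unfolding A_def by (auto intro: subring_gen.base)
    then show "r \<in> lspan A B" using lspan_scaled_base[of r A 1 B] B by simp
  qed
  moreover have "S \<subseteq> lspan A B" using Y by (auto simp: Y_def)
  ultimately have "subring_gen (R \<union> S) \<subseteq> lspan A B" by (intro subring_gen_least) auto
  then have UA: "lspan A B = UNIV" unfolding gen by auto
  have "l \<in> A" if "l \<in> L" for l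
  proof -
    obtain a where "\<forall>b\<in>B. a b \<in> A" "l = (\<Sum>b\<in>B. a b * b)"
      using lspan_imp_sum[OF B(1) As, of l] UA by auto
    moreover then have "\<forall>b\<in>B. a b \<in> L" using AL by blast
    ultimately show ?thesis using uniq that B(2) by metis
  qed
  then show ?thesis using that[OF finC CL] AL unfolding A_def by blast
qed

section \<open>Fields that are finitely generated as rings\<close>

lemma subring_set_sum:
  assumes "subring_set K" "\<And>i. i \<in> I \<Longrightarrow> f i \<in> K"
  shows "(\<Sum>i\<in>I. f i) \<in> K"
  using assms(2)
  by (induction I rule: infinite_finite_induct)
     (auto simp: subring_setD(2)[OF assms(1)] intro: subring_setD(6)[OF assms(1)])

text \<open>Subrings are sets here, while \<open>poly\<close> takes its coefficients from a type; a
  polynomial over \<open>R\<close> is one over the ambient ring with this restriction.\<close>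

definition coeffs_in :: "'a::zero set \<Rightarrow> 'a poly \<Rightarrow> bool" where
  "coeffs_in R p \<longleftrightarrow> (\<forall>i. poly.coeff p i \<in> R)"

lemma coeffs_in_mono: "coeffs_in R p \<Longrightarrow> R \<subseteq> T \<Longrightarrow> coeffs_in T p"
  by (auto simp: coeffs_in_def)

lemma coeffs_in_pCons: "a \<in> R \<Longrightarrow> coeffs_in R p \<Longrightarrow> coeffs_in R (pCons a p)"
  by (auto simp: coeffs_in_def coeff_pCons split: nat.split)

lemma subring_set_coeffs_in:
  fixes R :: "'a::comm_ring_1 set"
  assumes R: "subring_set R"
  shows "subring_set {p. coeffs_in R p}"
  unfolding subring_set_def
proof (intro conjI ballI)
  show "1 \<in> {p. coeffs_in R p}"
    using subring_setD(1,2)[OF R] by (auto simp: coeffs_in_def)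
next
  fix p q assume pq: "p \<in> {p. coeffs_in R p}" "q \<in> {p. coeffs_in R p}"
  show "p - q \<in> {p. coeffs_in R p}"
    using pq subring_setD(3)[OF R] by (auto simp: coeffs_in_def)
  show "p * q \<in> {p. coeffs_in R p}"
    using pq by (auto simp: coeffs_in_def coeff_mult intro!: subring_set_sum[OF R] subring_setD(4)[OF R])
qed

lemma coeffs_in_monom: "subring_set R \<Longrightarrow> a \<in> R \<Longrightarrow> coeffs_in R (Polynomial.monom a n)"
  using subring_setD(2) by (auto simp: coeffs_in_def coeff_monom)

lemma subring_set_poly_values:
  fixes R :: "'a::comm_ring_1 set"
  assumes "subring_set R"
  shows "subring_set {poly p x | p. coeffs_in R p}"
proof -
  note P = subring_setD[OF subring_set_coeffs_in[OF assms], unfolded mem_Collect_eq]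
  show ?thesis
    unfolding subring_set_def
  proof (intro conjI ballI)
    show "1 \<in> {poly p x | p. coeffs_in R p}"
      using P(1) by (intro CollectI exI[of _ 1]) simp
  next
    fix y z assume "y \<in> {poly p x | p. coeffs_in R p}" "z \<in> {poly p x | p. coeffs_in R p}"
    then obtain p q where pq: "y = poly p x" "coeffs_in R p" "z = poly q x" "coeffs_in R q" by blast
    show "y - z \<in> {poly p x | p. coeffs_in R p}"
      using P(3) pq by (intro CollectI exI[of _ "p - q"]) simp
    show "y * z \<in> {poly p x | p. coeffs_in R p}"
      using P(4) pq by (intro CollectI exI[of _ "p * q"]) simp
  qed
qed

lemma subring_gen_insert_subset:
  fixes R :: "'a::comm_ring_1 set"
  assumes R: "subring_set R"
  shows "subring_gen (insert x R) \<subseteq> {poly p x | p. coeffs_in R p}"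
proof (rule subring_gen_least[OF subring_set_poly_values[OF R]])
  have "\<exists>p. r = poly p x \<and> coeffs_in R p" if "r \<in> R" for r
    using coeffs_in_monom[OF R that, of 0] by (intro exI[of _ "Polynomial.monom r 0"]) (simp add: poly_monom)
  moreover have "\<exists>p. x = poly p x \<and> coeffs_in R p"
    using coeffs_in_monom[OF R subring_setD(1)[OF R], of 1]
    by (intro exI[of _ "Polynomial.monom 1 1"]) (simp add: poly_monom)
  ultimately show "insert x R \<subseteq> {poly p x | p. coeffs_in R p}" by blast
qed

lemma division_subring_divide:
  fixes L :: "'a::field set"
  assumes "division_subring L" "a \<in> L" "b \<in> L"
  shows "a / b \<in> L"
  using assms by (cases "b = 0") (auto simp: division_subring_def divide_inverse)

text \<open>Long division only ever divides by the leading coefficient of \<open>q\<close>, which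
  lies in the subfield \<open>L\<close>, so nothing leaves \<open>L\<close>.\<close>

lemma coeffs_in_division:
  fixes L :: "'a::field set"
  assumes L: "division_subring L" and q: "coeffs_in L q" "q \<noteq> 0" and p: "coeffs_in L p"
  obtains s r where "coeffs_in L s" "coeffs_in L r" "p = q * s + r"
    "r = 0 \<or> Polynomial.degree r < Polynomial.degree q"
proof -
  note Ls = division_subring_subring_set[OF L]
  note P = subring_setD[OF subring_set_coeffs_in[OF Ls], unfolded mem_Collect_eq]
  let ?D = "\<lambda>p. \<exists>s r. coeffs_in L s \<and> coeffs_in L r \<and> p = q * s + r
    \<and> (r = 0 \<or> Polynomial.degree r < Polynomial.degree q)"
  \<comment> \<open>Induction on a strict bound \<open>n\<close> for the exponents occurring in
    \<open>p\<close>, which also covers \<open>p = 0\<close>.\<close>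
  have "coeffs_in L p \<Longrightarrow> \<forall>i\<ge>n. poly.coeff p i = 0 \<Longrightarrow> ?D p" for n p
  proof (induction n arbitrary: p)
    case 0
    then have "p = 0" by (auto intro: poly_eqI)
    then show ?case using P(2) by (intro exI[of _ 0]) auto
  next
    case (Suc n)
    show ?case
    proof (cases "n < Polynomial.degree q")
      case True
      have "Polynomial.degree p \<le> n" using Suc.prems(2) by (intro degree_le) auto
      then show ?thesis using True P(2) Suc.prems(1) by (intro exI[of _ 0] exI[of _ p]) auto
    next
      case False
      define k where "k = n - Polynomial.degree q"
      \<comment> \<open>The monomial that cancels the coefficient of \<open>p\<close> at
        \<open>n\<close> against the leading term of \<open>q\<close>.\<close>
      define t where "t = Polynomial.monom (poly.coeff p n / Polynomial.lead_coeff q) k"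
      have t: "coeffs_in L t"
        unfolding t_def using Suc.prems(1) q
        by (intro coeffs_in_monom[OF Ls] division_subring_divide[OF L]) (auto simp: coeffs_in_def)
      have "poly.coeff (p - t * q) i = 0" if "i \<ge> n" for i
      proof (cases "i = n")
        case True
        then show ?thesis using q False by (simp add: t_def k_def coeff_monom_mult)
      next
        case ne: False
        then have "i - k > Polynomial.degree q" using that False by (auto simp: k_def)
        then show ?thesis using ne that Suc.prems(2) coeff_eq_0[of q "i - k"]
          by (simp add: t_def coeff_monom_mult)
      qed
      moreover have "coeffs_in L (p - t * q)" using P(3,4) t q Suc.prems(1) by blast
      ultimately obtain s r where sr: "coeffs_in L s" "coeffs_in L r" "p - t * q = q * s + r"
        "r = 0 \<or> Polynomial.degree r < Polynomial.degree q"
        using Suc.IH[of "p - t * q"] by blast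
      have "p = q * (s + t) + r" using sr(3) by (simp add: algebra_simps)
      then show ?thesis using sr P(6)[OF sr(1) t] by blast
    qed
  qed
  from this[OF p, of "Suc (Polynomial.degree p)"] show ?thesis
    using that coeff_eq_0[of p] by (simp add: Suc_le_eq) blast
qed

section \<open>Fractions and localization at one element\<close>

definition fracs :: "'a::field set \<Rightarrow> 'a set" where
  "fracs R = {a / b | a b. a \<in> R \<and> b \<in> R \<and> b \<noteq> 0}"

lemma subset_fracs: "subring_set R \<Longrightarrow> R \<subseteq> fracs R"
  using subring_setD(1) unfolding fracs_def by force

lemma division_subring_fracs:
  assumes R: "subring_set R"
  shows "division_subring (fracs R)"
  unfolding division_subring_def
proof (intro conjI ballI impI)
  note D = subring_setD[OF R]
  show "0 \<in> fracs R" "1 \<in> fracs R" using subset_fracs[OF R] D by auto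
  fix x assume "x \<in> fracs R"
  then obtain a b where x: "x = a / b" "a \<in> R" "b \<in> R" "b \<noteq> 0" by (auto simp: fracs_def)
  have "- x = (- a) / b" using x by simp
  then show "- x \<in> fracs R" using x D(5) unfolding fracs_def by blast
  show "inverse x \<in> fracs R" if "x \<noteq> 0"
  proof -
    have "inverse x = b / a" "a \<noteq> 0" using x that by auto
    then show ?thesis using x unfolding fracs_def by blast
  qed
  fix y assume "y \<in> fracs R"
  then obtain c d where y: "y = c / d" "c \<in> R" "d \<in> R" "d \<noteq> 0" by (auto simp: fracs_def)
  have "x * y = (a * c) / (b * d)" "x + y = (a * d + c * b) / (b * d)" "b * d \<noteq> 0"
    using x y by (auto simp: field_simps)
  moreover have "a * c \<in> R" "b * d \<in> R" "a * d + c * b \<in> R"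
    using x y D(4,6) by blast+
  ultimately show "x * y \<in> fracs R" "x + y \<in> fracs R" unfolding fracs_def by blast+
qed

text \<open>A product of denominators of the finitely many elements of \<open>C\<close> works: ring
  elements generated by them are cleared by some power of \<open>d\<close>, with an exponent
  depending on the element.\<close>

lemma common_denominator:
  assumes R: "subring_set R" and C: "finite C" "C \<subseteq> fracs R"
  obtains d where "d \<in> R" "d \<noteq> 0" "\<forall>z \<in> subring_gen (R \<union> C). \<exists>n. z * d ^ n \<in> R"
proof -
  note D = subring_setD[OF R]
  have "\<exists>d. d \<in> R \<and> d \<noteq> 0 \<and> (\<forall>c\<in>C. c * d \<in> R)"
    using C
  proof (induction C rule: finite_induct)
    case empty
    show ?case using D(1) by (intro exI[of _ 1]) auto
  next
    case (insert c C)
    then obtain d where d: "d \<in> R" "d \<noteq> 0" "\<forall>c\<in>C. c * d \<in> R" by auto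
    obtain a b where c: "c = a / b" "a \<in> R" "b \<in> R" "b \<noteq> 0" using insert.prems by (auto simp: fracs_def)
    have "c * (b * d) \<in> R" using D(4)[of a d] c d by simp
    moreover have "c' * (b * d) \<in> R" if "c' \<in> C" for c'
      using D(4)[of b "c' * d"] c d that by (simp add: mult.left_commute)
    ultimately have "\<forall>c'\<in>insert c C. c' * (b * d) \<in> R" by auto
    then show ?case using c d D(4) by (intro exI[of _ "b * d"]) auto
  qed
  then obtain d where d: "d \<in> R" "d \<noteq> 0" "\<forall>c\<in>C. c * d \<in> R" by auto
  have "\<exists>n. z * d ^ n \<in> R" if "z \<in> subring_gen (R \<union> C)" for z
    using that
  proof induction
    case (base x)
    then show ?case
    proof
      assume "x \<in> R" then show ?thesis by (intro exI[of _ 0]) simp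
    next
      assume "x \<in> C" then show ?thesis using d by (intro exI[of _ 1]) simp
    qed
  next
    case one
    show ?case using D(1) by (intro exI[of _ 0]) simp
  next
    case (diff x y)
    then obtain m n where mn: "x * d ^ m \<in> R" "y * d ^ n \<in> R" by auto
    have "(x - y) * d ^ (m + n) = (x * d ^ m) * d ^ n - (y * d ^ n) * d ^ m"
      by (simp add: algebra_simps power_add)
    moreover have "(x * d ^ m) * d ^ n - (y * d ^ n) * d ^ m \<in> R"
      by (rule D(3)[OF D(4)[OF mn(1) D(7)[OF d(1)]] D(4)[OF mn(2) D(7)[OF d(1)]]])
    ultimately show ?case by metis
  next
    case (mult x y)
    then obtain m n where mn: "x * d ^ m \<in> R" "y * d ^ n \<in> R" by auto
    have "(x * y) * d ^ (m + n) = (x * d ^ m) * (y * d ^ n)"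
      by (simp add: algebra_simps power_add)
    then show ?case using D(4)[OF mn] by metis
  qed
  then show ?thesis using that d by blast
qed

text \<open>Euclid's trick: \<open>1 + X f\<close> is coprime to \<open>f\<close> and not constant,
  so it is a denominator that no power of \<open>f\<close> clears.\<close>

lemma one_plus_X_mult_not_dvd_power:
  fixes f :: "'a::field poly"
  assumes "f \<noteq> 0"
  shows "\<not> (1 + [:0, 1:] * f) dvd f ^ n"
proof
  \<comment> \<open>\<open>1 - u\<close> divides both \<open>u ^ n\<close> and \<open>1 - u ^ n\<close>, so it is a unit.\<close>
  define u where "u = - ([:0, 1:] * f)"
  assume "(1 + [:0, 1:] * f) dvd f ^ n"
  moreover have "1 + [:0, 1:] * f = 1 - u" by (simp add: u_def)
  ultimately have "(1 - u) dvd (- [:0, 1:]) ^ n * f ^ n" by (metis dvd_mult)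
  then have "(1 - u) dvd u ^ n" by (simp add: u_def power_mult_distrib[symmetric])
  moreover have "(1 - u) dvd 1 - u ^ n"
    using one_diff_power_eq[of u n] by simp
  ultimately have "(1 - u) dvd 1" using dvd_add[of "1 - u" "1 - u ^ n" "u ^ n"] by simp
  then have "Polynomial.degree (1 - u) = 0" using dvd_imp_degree_le[of "1 - u" 1] by auto
  moreover have "Polynomial.degree (- u) = Suc (Polynomial.degree f)"
    using assms by (simp add: u_def)
  then have "Polynomial.degree (1 - u) = Suc (Polynomial.degree f)"
    using degree_add_eq_right[of 1 "- u"] by simp
  ultimately show False by simp
qed

text \<open>If \<open>x\<close> were transcendental over \<open>R\<close>, then \<open>R'\<close>
  would be a polynomial ring with \<open>d = f(x)\<close>, and no power of \<open>d\<close> would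
  carry the fraction \<open>1 / (1 + x * d)\<close> into \<open>R'\<close>.\<close>

lemma algebraic_if_fracs_localization:
  fixes R :: "'a::field set"
  assumes R: "subring_set R" and R': "R' = subring_gen (insert x R)"
    and d: "d \<in> R'" "d \<noteq> 0" and loc: "\<forall>z \<in> fracs R'. \<exists>n. z * d ^ n \<in> R'"
  obtains p where "coeffs_in R p" "p \<noteq> 0" "poly p x = 0"
proof (rule ccontr)
  assume "\<not> thesis"
  then have trans: "\<And>p. coeffs_in R p \<Longrightarrow> poly p x = 0 \<Longrightarrow> p = 0" using that by blast
  note P = subring_setD[OF subring_set_coeffs_in[OF R], unfolded mem_Collect_eq]
  note D = subring_setD[OF subring_set_subring_gen[of "insert x R"], folded R']
  obtain f where f: "coeffs_in R f" "poly f x = d"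
    using d(1) subring_gen_insert_subset[OF R] unfolding R' by blast
  have f0: "f \<noteq> 0" using f d by auto
  let ?g = "1 + [:0, 1:] * f"
  have g: "coeffs_in R ?g"
    using P(1,6) coeffs_in_pCons[OF subring_setD(2)[OF R] f(1)] by auto
  have "poly ?g 0 = 1" by simp
  then have "?g \<noteq> 0" by (metis poly_0 zero_neq_one)
  then have nz: "1 + x * d \<noteq> 0" using trans[OF g] f by auto
  have "x \<in> R'" unfolding R' by (auto intro: subring_gen.base)
  then have "1 / (1 + x * d) \<in> fracs R'"
    using nz D(1,4,6) d(1) unfolding fracs_def by blast
  then obtain n where "1 / (1 + x * d) * d ^ n \<in> R'" using loc by auto
  then obtain q where q: "coeffs_in R q" "poly q x = 1 / (1 + x * d) * d ^ n"
    using subring_gen_insert_subset[OF R] unfolding R' by fastforce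
  have "poly (f ^ n - ?g * q) x = 0" using q f nz by (simp add: field_simps)
  moreover have "coeffs_in R (f ^ n - ?g * q)" using P(3,4,7) f(1) g q(1) by blast
  \<comment> \<open>Transcendence turns equality of values at \<open>x\<close> into equality of
    polynomials.\<close>
  ultimately have "f ^ n = ?g * q" using trans by fastforce
  then show False using one_plus_X_mult_not_dvd_power[OF f0, of n] by (metis dvd_triv_left)
qed

text \<open>Bezout's argument for \<open>q\<close> and a minimal polynomial \<open>m\<close> of
  \<open>x\<close>, with values at \<open>x\<close> in place of congruences modulo \<open>m\<close>:
  \<open>?T\<close> collects the nonzero polynomials whose value is a multiple of
  \<open>poly q x\<close>.\<close>

lemma algebraic_poly_inverse:
  fixes L :: "'a::field set"
  assumes L: "division_subring L" and p: "coeffs_in L p" "p \<noteq> 0" "poly p x = 0"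
    and q: "coeffs_in L q" "poly q x \<noteq> 0"
  obtains t where "coeffs_in L t" "poly q x * poly t x = 1"
proof -
  note Ls = division_subring_subring_set[OF L]
  note P = subring_setD[OF subring_set_coeffs_in[OF Ls], unfolded mem_Collect_eq]
  let ?Z = "\<lambda>p. coeffs_in L p \<and> p \<noteq> 0 \<and> poly p x = 0"
  let ?T = "\<lambda>t. coeffs_in L t \<and> t \<noteq> 0 \<and> (\<exists>s. coeffs_in L s \<and> poly t x = poly q x * poly s x)"
  have "?Z p" using p by simp
  then have "\<exists>m. ?Z m \<and> (\<forall>m'. ?Z m' \<longrightarrow> Polynomial.degree m \<le> Polynomial.degree m')"
    by (rule ex_has_least_nat)
  then obtain m where m: "?Z m" and mmin: "\<And>m'. ?Z m' \<Longrightarrow> Polynomial.degree m \<le> Polynomial.degree m'"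
    by blast
  \<comment> \<open>A least-degree element \<open>t\<close> of \<open>?T\<close> divides \<open>m\<close> and \<open>q\<close>; minimality of \<open>m\<close> forces \<open>t\<close> to be constant.\<close>
  have Tq: "?T q" using q P(1) by (intro conjI exI[of _ 1]) auto
  then have "\<exists>t. ?T t \<and> (\<forall>t'. ?T t' \<longrightarrow> Polynomial.degree t \<le> Polynomial.degree t')"
    by (rule ex_has_least_nat)
  then obtain t where t: "?T t" and tmin: "\<And>t'. ?T t' \<Longrightarrow> Polynomial.degree t \<le> Polynomial.degree t'"
    by blast
  then obtain s where s: "coeffs_in L s" "poly t x = poly q x * poly s x" by blast
  have div: "\<exists>c. coeffs_in L c \<and> f = t * c"
    if f: "coeffs_in L f" and fs: "coeffs_in L s'" "poly f x = poly q x * poly s' x" for f s'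
  proof -
    obtain c r where cr: "coeffs_in L c" "coeffs_in L r" "f = t * c + r"
      "r = 0 \<or> Polynomial.degree r < Polynomial.degree t"
      using coeffs_in_division[OF L _ _ f, of t] t by blast
    have "poly r x = poly q x * poly (s' - s * c) x"
      using cr(3) fs(2) s(2) by (simp add: algebra_simps)
    moreover have "coeffs_in L (s' - s * c)" using P(3,4) fs(1) s(1) cr(1) by blast
    ultimately have "?T r" if "r \<noteq> 0" using that cr(2) by blast
    then have "r = 0" using tmin[of r] cr(4) by (meson not_le)
    then show ?thesis using cr by auto
  qed
  \<comment> \<open>Both \<open>m\<close> and \<open>q\<close> qualify for \<open>div\<close>, with
    multipliers 0 and 1.\<close>
  obtain c where c: "coeffs_in L c" "m = t * c"
    using div[of m 0] m P(2) by auto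
  obtain e where e: "q = t * e" using div[of q 1] q P(1) by auto
  have tx: "poly t x \<noteq> 0" using e q by auto
  \<comment> \<open>As \<open>t\<close> does not vanish at \<open>x\<close>, its cofactor
    \<open>c\<close> does; so \<open>c\<close> has at least the degree of \<open>m\<close>, and
    \<open>t\<close> is constant.\<close>
  then have "?Z c" using c m by auto
  then have "Polynomial.degree m \<le> Polynomial.degree c" by (rule mmin)
  moreover have "Polynomial.degree m = Polynomial.degree t + Polynomial.degree c"
    using c m t by (auto simp: degree_mult_eq)
  ultimately have "Polynomial.degree t = 0" by simp
  then obtain a where a: "t = [:a:]" by (metis degree_eq_zeroE)
  have aL: "a \<in> L" using t a unfolding coeffs_in_def by (metis coeff_pCons_0)
  have a0: "a \<noteq> 0" using a t by auto
  have "1 / a \<in> L" using division_subring_divide[OF L subring_setD(1)[OF Ls] aL] .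
  then have "coeffs_in L [:1 / a:]" using coeffs_in_pCons P(2) by blast
  then have "coeffs_in L (s * [:1 / a:])" by (rule P(4)[OF s(1)])
  moreover have "poly q x * poly (s * [:1 / a:]) x = 1"
    using s(2) a a0 by (simp add: field_simps)
  ultimately show ?thesis using that by blast
qed

text \<open>The values at \<open>x\<close> of polynomials over \<open>fracs R\<close> form a ring
  closed under inverses by \<open>algebraic_poly_inverse\<close>, so it contains all the fractions;
  division by \<open>p\<close> leaves only powers of \<open>x\<close> below its degree.\<close>

lemma fracs_algebraic_extension_fin_dim:
  fixes R :: "'a::field set"
  assumes R: "subring_set R" and p: "coeffs_in R p" "p \<noteq> 0" "poly p x = 0"
  obtains B where "finite B" "fracs (subring_gen (insert x R)) \<subseteq> lspan (fracs R) B"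
proof -
  let ?L = "fracs R"
  let ?M = "{poly q x | q. coeffs_in ?L q}"
  let ?B = "(\<lambda>i. x ^ i) ` {..<Polynomial.degree p}"
  note L = division_subring_fracs[OF R]
  note Ls = division_subring_subring_set[OF L]
  note Ms = subring_set_poly_values[OF Ls, of x]
  have pL: "coeffs_in ?L p" using coeffs_in_mono[OF p(1) subset_fracs[OF R]] .
  have R'M: "subring_gen (insert x R) \<subseteq> ?M"
    using subring_gen_insert_subset[OF R, of x] coeffs_in_mono[OF _ subset_fracs[OF R]] by blast
  have "fracs (subring_gen (insert x R)) \<subseteq> ?M"
  proof
    fix z assume "z \<in> fracs (subring_gen (insert x R))"
    then obtain a b where ab: "z = a / b" "a \<in> ?M" "b \<in> ?M" "b \<noteq> 0"
      using R'M unfolding fracs_def by blast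
    then obtain q where q: "coeffs_in ?L q" "b = poly q x" by blast
    obtain t where t: "coeffs_in ?L t" "poly q x * poly t x = 1"
      using ab q by (auto intro: algebraic_poly_inverse[OF L pL p(2,3) q(1)])
    have z: "z = a * poly t x"
      using ab(1) inverse_unique[OF t(2)] q(2) by (simp add: divide_inverse)
    have "poly t x \<in> ?M" using t by blast
    then show "z \<in> ?M" unfolding z by (rule subring_setD(4)[OF Ms ab(2)])
  qed
  moreover have "?M \<subseteq> lspan ?L ?B"
  proof
    fix z assume "z \<in> ?M"
    then obtain q where q: "coeffs_in ?L q" "z = poly q x" by blast
    obtain s r where sr: "coeffs_in ?L s" "coeffs_in ?L r" "q = p * s + r"
      "r = 0 \<or> Polynomial.degree r < Polynomial.degree p"
      by (rule coeffs_in_division[OF L pL p(2) q(1)])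
    have "z = poly r x" using q sr p by simp
    moreover have "poly r x \<in> lspan ?L ?B"
    proof (cases "r = 0")
      case False
      have "(\<Sum>i\<in>I. poly.coeff r i * x ^ i) \<in> lspan ?L ?B" if "finite I" "I \<subseteq> {..<Polynomial.degree p}" for I
        using that
        by (induction I rule: finite_induct)
           (use sr(2) in \<open>auto simp: coeffs_in_def intro!: lspan.intros\<close>)
      then show ?thesis using sr(4) False unfolding poly_altdef by (auto simp: subset_iff)
    qed (simp add: lspan.zero)
    ultimately show "z \<in> lspan ?L ?B" by simp
  qed
  ultimately show ?thesis using that[of ?B] by blast
qed

lemma lspan_tower:
  assumes K: "subring_set K" and L: "L \<subseteq> lspan K B"
  shows "lspan L C \<subseteq> lspan K ((\<lambda>(b, c). b * c) ` (B \<times> C))"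
proof
  fix x assume "x \<in> lspan L C"
  then show "x \<in> lspan K ((\<lambda>(b, c). b * c) ` (B \<times> C))" (is "_ \<in> ?T")
  proof induction
    case (add l c y)
    have "l * c \<in> ?T" if "l \<in> lspan K B" for l
      using that
    proof induction
      case (add k b w)
      have "(k * b + w) * c = k * (b * c) + w * c" by (simp add: algebra_simps)
      moreover have "k * (b * c) + w * c \<in> ?T"
        by (rule lspan.add) (use add \<open>c \<in> C\<close> in auto)
      ultimately show ?case by simp
    qed (simp add: lspan.zero)
    then show ?case using add L by (auto intro: lspan_add)
  qed (rule lspan.zero)
qed

text \<open>Stated over the fractions of an arbitrary subring, because the induction replaces
  \<open>R\<close> by \<open>R[x]\<close> and the application starts from the integers. Finite
  dimension over \<open>fracs R'\<close> makes \<open>fracs R'\<close> a localization of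
  \<open>R'\<close> at one element, which forces \<open>x\<close> to be algebraic over
  \<open>R\<close>.\<close>

theorem Zariski_lemma_fracs:
  fixes R :: "'a::field set"
  assumes "finite S" "subring_set R" "subring_gen (R \<union> S) = UNIV"
  shows "fin_dim_over UNIV (fracs R)"
  using assms
proof (induction S arbitrary: R rule: finite_induct)
  case empty
  then have "R = UNIV" by (simp add: subring_gen_subring_set)
  then have "fracs R = UNIV" using subset_fracs[OF empty.prems(1)] by auto
  moreover have "x \<in> lspan UNIV {1}" for x :: 'a
    using lspan_scaled_base[of x UNIV 1 "{1}"] by simp
  then have "lspan UNIV {1::'a} = UNIV" by auto
  moreover have "subring_set (UNIV :: 'a set)" by (simp add: subring_set_def)
  ultimately show ?case
    using fin_dim_over_UNIV_iff[of "UNIV :: 'a set"] by (auto intro: exI[of _ "{1}"])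
next
  case (insert x S)
  note R = insert.prems(1)
  define R' where "R' = subring_gen (insert x R)"
  have R': "subring_set R'" unfolding R'_def by (rule subring_set_subring_gen)
  have RR': "insert x R \<subseteq> R'" unfolding R'_def by (rule subring_gen_superset)
  have "R \<union> insert x S \<subseteq> subring_gen (R' \<union> S)"
    using RR' subring_gen_superset[of "R' \<union> S"] by auto
  then have "subring_gen (R \<union> insert x S) \<subseteq> subring_gen (R' \<union> S)"
    by (rule subring_gen_least[OF subring_set_subring_gen])
  then have gen: "subring_gen (R' \<union> S) = UNIV" unfolding insert.prems(2) by auto
  note fd = insert.IH[OF R' gen]
  note L' = division_subring_fracs[OF R']
  obtain C where C: "finite C" "C \<subseteq> fracs R'" "fracs R' = subring_gen (R' \<union> C)"
    by (rule Artin_Tate[OF L' mult.commute fd subset_fracs[OF R'] insert.hyps(1) gen])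
  obtain d where d: "d \<in> R'" "d \<noteq> 0" "\<forall>z \<in> subring_gen (R' \<union> C). \<exists>n. z * d ^ n \<in> R'"
    by (rule common_denominator[OF R' C(1,2)])
  obtain p where p: "coeffs_in R p" "p \<noteq> 0" "poly p x = 0"
    by (rule algebraic_if_fracs_localization[OF R R'_def d(1,2) d(3)[folded C(3)]])
  obtain B1 where B1: "finite B1" "fracs R' \<subseteq> lspan (fracs R) B1"
    unfolding R'_def by (rule fracs_algebraic_extension_fin_dim[OF R p])
  obtain B2 where B2: "finite B2" "lspan (fracs R') B2 = UNIV"
    using fd fin_dim_over_UNIV_iff[OF division_subring_subring_set[OF L']] by auto
  note Ls = division_subring_subring_set[OF division_subring_fracs[OF R]]
  have "lspan (fracs R) ((\<lambda>(b, c). b * c) ` (B1 \<times> B2)) = UNIV"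
    using lspan_tower[OF Ls B1(2), of B2] unfolding B2(2) by auto
  moreover have "finite ((\<lambda>(b, c). b * c) ` (B1 \<times> B2))" using B1 B2 by simp
  ultimately show ?case unfolding fin_dim_over_UNIV_iff[OF Ls] by blast
qed

lemma finite_lspan:
  assumes "subring_set L" "finite L" "finite B"
  shows "finite (lspan L B)"
proof (rule finite_subset)
  show "lspan L B \<subseteq> (\<lambda>c. \<Sum>b\<in>B. c b * b) ` (B \<rightarrow>\<^sub>E L)"
  proof
    fix x assume "x \<in> lspan L B"
    then obtain c where c: "\<forall>b\<in>B. c b \<in> L" "x = (\<Sum>b\<in>B. c b * b)"
      using lspan_imp_sum[OF assms(3,1)] by blast
    have "x = (\<Sum>b\<in>B. restrict c B b * b)" unfolding c(2) by (intro sum.cong) auto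
    moreover have "restrict c B \<in> B \<rightarrow>\<^sub>E L" using c by auto
    ultimately show "x \<in> (\<lambda>c. \<Sum>b\<in>B. c b * b) ` (B \<rightarrow>\<^sub>E L)" by blast
  qed
qed (use assms in \<open>auto intro: finite_PiE\<close>)

text \<open>With \<open>R\<close> the image of the integers, the previous results give one
  \<open>d\<close> whose powers clear all fractions of \<open>R\<close>. The rationals have no such
  \<open>d\<close>, so the characteristic is positive; then \<open>R\<close> and its fractions are
  finite, and the field is finite dimensional over them.\<close>

theorem finitely_generated_ring_field_finite:
  fixes S :: "'a::field set"
  assumes S: "finite S" and gen: "subring_gen S = UNIV"
  shows "finite (UNIV :: 'a set)"
proof -
  define R where "R = range (of_int :: int \<Rightarrow> 'a)"
  have R: "subring_set R" unfolding subring_set_def R_def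
    by (auto simp del: of_int_diff of_int_mult simp: of_int_diff[symmetric] of_int_mult[symmetric]
        intro: range_eqI[of _ _ 1])
  have "subring_gen S \<subseteq> subring_gen (R \<union> S)"
    using subring_gen_superset[of "R \<union> S"] by (intro subring_gen_least[OF subring_set_subring_gen]) auto
  then have gen': "subring_gen (R \<union> S) = UNIV" unfolding gen by auto
  note L = division_subring_fracs[OF R]
  note Ls = division_subring_subring_set[OF L]
  note fd = Zariski_lemma_fracs[OF S R gen']
  obtain C where C: "finite C" "C \<subseteq> fracs R" "fracs R = subring_gen (R \<union> C)"
    by (rule Artin_Tate[OF L mult.commute fd subset_fracs[OF R] S gen'])
  obtain d where d: "d \<in> R" "d \<noteq> 0" "\<forall>z \<in> subring_gen (R \<union> C). \<exists>n. z * d ^ n \<in> R"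
    by (rule common_denominator[OF R C(1,2)])
  obtain k where k: "d = of_int k" using d(1) by (auto simp: R_def)
  have "\<exists>m>0. (of_int m :: 'a) = 0"
  proof (rule ccontr)
    assume neg: "\<not> (\<exists>m>0. (of_int m :: 'a) = 0)"
    have nz: "(of_int m :: 'a) \<noteq> 0" if "m \<noteq> 0" for m
      using neg that by (metis neg_0_less_iff_less neg_equal_0_iff_equal not_less_iff_gr_or_eq of_int_minus)
    then have inj: "a = b" if "(of_int a :: 'a) = of_int b" for a b
      using that by (metis eq_iff_diff_eq_0 of_int_diff)
    \<comment> \<open>As \<open>k\<close> is nonzero, a prime exceeding its absolute value divides
      no power of \<open>k\<close>, so \<open>1 / q\<close> keeps its denominator.\<close>
    obtain q :: nat where q: "normalization_semidom_class.prime q" "q > nat \<bar>k\<bar>" using bigger_prime by blast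
    have q0: "(of_int (int q) :: 'a) \<noteq> 0" using q(1) by (intro nz) (auto simp: prime_gt_0_nat)
    have "1 / of_int (int q) \<in> fracs R"
      using q0 subring_setD(1)[OF R] unfolding fracs_def R_def by blast
    then obtain n where "1 / of_int (int q) * d ^ n \<in> R" using d(3) C(3) by auto
    then obtain a where "1 / of_int (int q) * d ^ n = of_int a" by (auto simp: R_def)
    then have "d ^ n = of_int a * of_int (int q)" using q0 by (simp add: field_simps)
    then have "k ^ n = a * int q" by (intro inj) (simp add: k)
    then have "int q dvd k ^ n" by simp
    then have "int q dvd k" using q(1) prime_dvd_power[of "int q" k n] by simp
    then have "q \<le> nat \<bar>k\<bar>" using d(2) k dvd_imp_le_int[of k "int q"] by fastforce
    then show False using q(2) by simp
  qed
  then obtain m where m: "m > 0" "(of_int m :: 'a) = 0" by blast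
  have "R \<subseteq> of_int ` {0..<m}"
  proof
    fix r assume "r \<in> R"
    then obtain i where "r = of_int i" by (auto simp: R_def)
    also have "\<dots> = of_int (i div m * m + i mod m)" by simp
    also have "\<dots> = of_int (i mod m)" using m(2) by (simp only: of_int_add of_int_mult) simp
    finally show "r \<in> of_int ` {0..<m}" using m(1) by auto
  qed
  then have "finite R" using finite_subset by blast
  then have "finite ((\<lambda>(a, b). a / b) ` (R \<times> R))" by simp
  moreover have "fracs R \<subseteq> (\<lambda>(a, b). a / b) ` (R \<times> R)" by (auto simp: fracs_def)
  ultimately have "finite (fracs R)" by (rule rev_finite_subset)
  moreover obtain B where "finite B" "lspan (fracs R) B = UNIV"
    using fd fin_dim_over_UNIV_iff[OF Ls] by auto
  ultimately show ?thesis using finite_lspan[OF Ls, of B] by simp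
qed

section \<open>The center as a field\<close>

lemma center_of_UNIV_iff: "z \<in> center_of UNIV \<longleftrightarrow> (\<forall>x. z * x = x * z)"
  by (simp add: center_of_def)

lemma center_commutes: "z \<in> center_of UNIV \<Longrightarrow> z * x = x * z"
  unfolding center_of_UNIV_iff by blast

lemma division_subring_center: "division_subring (center_of (UNIV :: 'a::division_ring set))"
proof -
  have "(x + y) * w = w * (x + y)" "x * y * w = w * (x * y)"
    if c: "\<forall>w. x * w = w * x" "\<forall>w. y * w = w * y" for x y w :: 'a
  proof -
    show "(x + y) * w = w * (x + y)" using c by (simp add: distrib_left distrib_right)
    have "x * y * w = x * w * y" using c(2) by (simp add: mult.assoc)
    then show "x * y * w = w * (x * y)" using spec[OF c(1), of w] by (simp add: mult.assoc)
  qed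
  moreover have "inverse x * w = w * inverse x" if "\<forall>w. x * w = w * x" "x \<noteq> 0" for x w :: 'a
  proof -
    have "inverse x * (x * w) * inverse x = inverse x * (w * x) * inverse x"
      by (simp only: spec[OF that(1), of w])
    moreover have "inverse x * (x * w) * inverse x = w * inverse x"
      using that(2) by (simp add: mult.assoc[symmetric])
    moreover have "inverse x * (w * x) * inverse x = inverse x * w"
      using that(2) by (simp add: mult.assoc)
    ultimately show ?thesis by simp
  qed
  moreover have "- x * w = w * - x" if "\<forall>w. x * w = w * x" for x w :: 'a
    using spec[OF that, of w] by simp
  moreover have "0 * w = w * 0" "1 * w = w * 1" for w :: 'a by simp_all
  ultimately show ?thesis
    unfolding division_subring_def Ball_def center_of_UNIV_iff by blast
qed

lemmas center_ring_closed =
  subring_setD[OF division_subring_subring_set[OF division_subring_center]]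

lemma center_inverse:
  fixes x :: "'a::division_ring"
  shows "x \<in> center_of UNIV \<Longrightarrow> inverse x \<in> center_of UNIV"
  using division_subring_center[where ?'a = 'a] unfolding division_subring_def by (cases "x = 0") simp_all

text \<open>Turns the center into a type of class \<open>field\<close>, since the finiteness theorem
  for fields is stated for types.\<close>

typedef (overloaded) 'a center_field = "center_of (UNIV :: 'a::division_ring set)"
  by (rule exI, rule center_ring_closed(1))

setup_lifting type_definition_center_field

instantiation center_field :: (division_ring) field
begin

lift_definition zero_center_field :: "'a center_field" is 0
  by (rule center_ring_closed)

lift_definition one_center_field :: "'a center_field" is 1
  by (rule center_ring_closed)

lift_definition plus_center_field :: "'a center_field \<Rightarrow> 'a center_field \<Rightarrow> 'a center_field" is "(+)"
  by (rule center_ring_closed)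

lift_definition times_center_field :: "'a center_field \<Rightarrow> 'a center_field \<Rightarrow> 'a center_field" is "(*)"
  by (rule center_ring_closed)

lift_definition uminus_center_field :: "'a center_field \<Rightarrow> 'a center_field" is uminus
  by (rule center_ring_closed)

lift_definition minus_center_field :: "'a center_field \<Rightarrow> 'a center_field \<Rightarrow> 'a center_field" is "(-)"
  by (rule center_ring_closed)

lift_definition inverse_center_field :: "'a center_field \<Rightarrow> 'a center_field" is inverse
  by (rule center_inverse)

definition divide_center_field :: "'a center_field \<Rightarrow> 'a center_field \<Rightarrow> 'a center_field" where
  "divide_center_field x y = x * inverse y"

instance
proof
  fix a b c :: "'a center_field"
  show "a + b + c = a + (b + c)" by transfer (rule add.assoc)
  show "a + b = b + a" by transfer (rule add.commute)
  show "0 + a = a" by transfer simp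
  show "- a + a = 0" by transfer simp
  show "a - b = a + - b" by transfer simp
  show "a * b * c = a * (b * c)" by transfer (rule mult.assoc)
  show "a * b = b * a" by transfer (rule center_commutes)
  show "1 * a = a" by transfer simp
  show "(a + b) * c = a * c + b * c" by transfer (rule distrib_right)
  show "(0 :: 'a center_field) \<noteq> 1" by transfer simp
  show "a \<noteq> 0 \<Longrightarrow> inverse a * a = 1" by transfer simp
  show "a div b = a * inverse b" by (rule divide_center_field_def)
  show "inverse (0 :: 'a center_field) = 0" by transfer simp
qed

end

text \<open>Artin--Tate with an empty base ring makes the center finitely generated as a ring. Being
  a field, it is then finite, and so is a finite dimensional space over it.\<close>

theorem finitely_generated_ring_center_fin_dim_finite:
  fixes S :: "'a::division_ring set"
  assumes S: "finite S" and gen: "subring_gen S = UNIV"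
    and fd: "fin_dim_over UNIV (center_of (UNIV :: 'a set))"
  shows "finite (UNIV :: 'a set)"
proof -
  let ?F = "center_of (UNIV :: 'a set)"
  note F = division_subring_center[where ?'a = 'a]
  note Fs = division_subring_subring_set[OF F]
  have gen': "subring_gen ({} \<union> S) = UNIV" using gen by simp
  obtain C where C: "finite C" "C \<subseteq> ?F" "?F = subring_gen ({} \<union> C)"
    by (rule Artin_Tate[OF F _ fd empty_subsetI S gen']) (erule center_commutes)
  \<comment> \<open>\<open>Abs_center_field\<close> respects ring operations on central elements;
    \<open>C(3)\<close> ensures that all elements of \<open>subring_gen C\<close> are
    central.\<close>
  have "Abs_center_field z \<in> subring_gen (Abs_center_field ` C)" if "z \<in> subring_gen C" for z
    using that
  proof induction
    case (diff x y)
    then have "Abs_center_field (x - y) = Abs_center_field x - Abs_center_field y"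
      using C(3) by (simp add: minus_center_field.abs_eq eq_onp_def)
    then show ?case using diff by (simp add: subring_gen.diff)
  next
    case (mult x y)
    then have "Abs_center_field (x * y) = Abs_center_field x * Abs_center_field y"
      using C(3) by (simp add: times_center_field.abs_eq eq_onp_def)
    then show ?case using mult by (simp add: subring_gen.mult)
  qed (auto simp: one_center_field.abs_eq[symmetric] intro: subring_gen.base subring_gen.one)
  then have "x \<in> subring_gen (Abs_center_field ` C)" for x :: "'a center_field"
    using C(3) by (cases x) auto
  then have "finite (UNIV :: 'a center_field set)"
    using C(1) by (intro finitely_generated_ring_field_finite[of "Abs_center_field ` C"]) auto
  then have "finite (range (Rep_center_field :: 'a center_field \<Rightarrow> 'a))" by simp
  then have "finite ?F" by (simp add: type_definition.Rep_range[OF type_definition_center_field])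
  moreover obtain B where "finite B" "lspan ?F B = UNIV"
    using fd fin_dim_over_UNIV_iff[OF Fs] by auto
  ultimately show ?thesis using finite_lspan[OF Fs, of B] by simp
qed

section \<open>Transvections and transitivity\<close>

text \<open>Phrased with \<open>**\<close> and \<open>mat 1\<close> directly, so that matrix
  computations need no group records; \<open>mat_group_subgroup\<close> is the link to
  \<open>GL\<close>.\<close>

definition mat_group :: "('a::division_ring^'n^'n) set \<Rightarrow> bool" where
  "mat_group H \<longleftrightarrow> mat 1 \<in> H \<and> (\<forall>x\<in>H. \<forall>y\<in>H. x ** y \<in> H) \<and>
     (\<forall>x\<in>H. \<exists>y\<in>H. x ** y = mat 1 \<and> y ** x = mat 1)"

definition mat_normal :: "('a::division_ring^'n^'n) set \<Rightarrow> ('a^'n^'n) set \<Rightarrow> bool" where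
  "mat_normal H K \<longleftrightarrow> mat_group H \<and> mat_group K \<and> H \<subseteq> K \<and>
     (\<forall>k\<in>K. \<forall>k'\<in>K. \<forall>h\<in>H. k ** k' = mat 1 \<longrightarrow> k' ** k = mat 1 \<longrightarrow> k ** h ** k' \<in> H)"

lemma mat_groupD:
  assumes "mat_group H"
  shows "mat 1 \<in> H" "x \<in> H \<Longrightarrow> y \<in> H \<Longrightarrow> x ** y \<in> H"
    "x \<in> H \<Longrightarrow> \<exists>y\<in>H. x ** y = mat 1 \<and> y ** x = mat 1"
  using assms unfolding mat_group_def by blast+

lemma mat_normalD:
  assumes "mat_normal H K"
  shows "mat_group H" "mat_group K" "h \<in> H \<Longrightarrow> h \<in> K"
    "k \<in> K \<Longrightarrow> k' \<in> K \<Longrightarrow> h \<in> H \<Longrightarrow> k ** k' = mat 1 \<Longrightarrow> k' ** k = mat 1 \<Longrightarrow> k ** h ** k' \<in> H"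
  using assms unfolding mat_normal_def by blast+

lemma mat_inverse_unique:
  fixes x :: "'a::semiring_1^'n^'n"
  assumes "x ** y = mat 1" "z ** x = mat 1"
  shows "y = z"
proof -
  have "z ** (x ** y) = z ** x ** y" by (rule matrix_mul_assoc)
  then show ?thesis using assms by simp
qed

lemma mat_group_inverse:
  assumes "mat_group H" "x \<in> H" "x ** y = mat 1"
  shows "y \<in> H"
proof -
  obtain z where z: "z \<in> H" "x ** z = mat 1" "z ** x = mat 1" using mat_groupD(3)[OF assms(1,2)] by blast
  then show ?thesis using mat_inverse_unique[OF assms(3) z(3)] by simp
qed

definition outer :: "'a::semiring_1^'n \<Rightarrow> 'a^'n \<Rightarrow> 'a^'n^'n" where
  "outer u f = (\<chi> i j. u $ i * f $ j)"

definition dotp :: "'a::semiring_1^'n \<Rightarrow> 'a^'n \<Rightarrow> 'a" where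
  "dotp f u = (\<Sum>i\<in>UNIV. f $ i * u $ i)"

text \<open>Matrices act on columns from the left, so column vectors form a right vector space.\<close>

definition rscale :: "'a::semiring_1^'n \<Rightarrow> 'a \<Rightarrow> 'a^'n" where
  "rscale u c = (\<chi> i. u $ i * c)"

text \<open>A transvection when \<open>dotp f u = 0\<close>; that condition is left to the lemmas,
  so that conjugation can be computed for all pairs \<open>u\<close>, \<open>f\<close>.\<close>

definition transv :: "'a::semiring_1^'n \<Rightarrow> 'a^'n \<Rightarrow> 'a^'n^'n" where
  "transv u f = mat 1 + outer u f"

text \<open>The usual \<open>I + a E_ij\<close>, elementary for distinct \<open>i\<close> and
  \<open>j\<close>, written as a transvection to share the calculus.\<close>

definition elem_mat :: "'n \<Rightarrow> 'n \<Rightarrow> 'a::semiring_1 \<Rightarrow> 'a^'n^'n" where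
  "elem_mat i j a = transv (axis i a) (axis j 1)"

lemma dotp_axis [simp]: "dotp (axis j c) u = c * u $ j" "dotp f (axis j c) = f $ j * c"
proof -
  have "axis j c $ i * u $ i = (if i = j then c * u $ j else 0)" for i by (simp add: axis_def)
  then show "dotp (axis j c) u = c * u $ j" by (simp add: dotp_def)
  have "f $ i * axis j c $ i = (if i = j then f $ j * c else 0)" for i by (simp add: axis_def)
  then show "dotp f (axis j c) = f $ j * c" by (simp add: dotp_def)
qed

lemma rscale_axis [simp]: "rscale (axis i a) c = axis i (a * c)"
  by (auto simp: rscale_def axis_def vec_eq_iff)

lemma outer_axis: "outer (axis i a) (axis j b) = outer (axis i (a * b)) (axis j 1)"
  by (simp add: outer_def axis_def vec_eq_iff)

lemma transv_axis: "transv (axis i a) (axis j b) = elem_mat i j (a * b)"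
  unfolding elem_mat_def transv_def outer_axis[of i a j b] ..

lemma matrix_mult_add_distrib_right: "((A::'a::semiring_1^'n^'n) + B) ** C = A ** C + B ** C"
  by (simp add: matrix_matrix_mult_def vec_eq_iff distrib_right sum.distrib)

lemma matrix_mult_outer: "A ** outer u f = outer (A *v u) f"
  by (simp add: matrix_matrix_mult_def matrix_vector_mult_def outer_def vec_eq_iff sum_distrib_right mult.assoc)

lemma outer_matrix_mult: "outer u f ** A = outer u (f v* A)"
  by (simp add: matrix_matrix_mult_def vector_matrix_mult_def outer_def vec_eq_iff sum_distrib_left mult.assoc)

lemma outer_matrix_vector: "outer u f *v x = rscale u (dotp f x)"
  by (simp add: matrix_vector_mult_def outer_def rscale_def dotp_def vec_eq_iff sum_distrib_left mult.assoc)

lemma vector_matrix_outer: "f v* outer u g = (\<chi> j. dotp f u * g $ j)"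
  by (simp add: vector_matrix_mult_def outer_def dotp_def vec_eq_iff sum_distrib_right mult.assoc)

lemma transv_vector: "transv u f *v x = x + rscale u (dotp f x)"
  by (simp add: transv_def matrix_vector_mult_add_rdistrib outer_matrix_vector)

lemma vector_transv: "f v* transv u g = f + (\<chi> j. dotp f u * g $ j)"
proof -
  have "f v* transv u g = f v* mat 1 + f v* outer u g"
    by (simp add: transv_def vector_matrix_mult_def vec_eq_iff distrib_left sum.distrib)
  then show ?thesis by (simp add: vector_matrix_outer)
qed

lemma elem_mat_vector: "elem_mat i j a *v x = x + axis i (a * x $ j)"
  by (simp add: elem_mat_def transv_vector)

lemma vector_elem_mat: "f v* elem_mat i j a = f + axis j (f $ i * a)"
  by (simp add: elem_mat_def vector_transv) (simp add: vec_eq_iff axis_def)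

lemma transv_0 [simp]: "transv 0 f = mat 1" "transv u 0 = mat 1"
  by (auto simp: transv_def outer_def vec_eq_iff)

lemma matrix_mult_transv: "M ** transv u f = M + outer (M *v u) f"
  by (simp add: transv_def matrix_add_ldistrib matrix_mult_outer)

lemma transv_matrix_mult: "transv u f ** M = M + outer u (f v* M)"
  by (simp add: transv_def matrix_mult_add_distrib_right outer_matrix_mult)

lemma rscale_0 [simp]: "rscale u 0 = 0"
  by (simp add: rscale_def vec_eq_iff)

lemma transv_mult_left: "dotp f v = 0 \<Longrightarrow> transv u f ** transv v f = transv (u + v) f"
  unfolding matrix_mult_transv[of "transv u f"] transv_vector
  by (simp add: transv_def outer_def vec_eq_iff distrib_right add.assoc)

lemma transv_mult_right: "dotp f u = 0 \<Longrightarrow> transv u f ** transv u g = transv u (f + g)"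
  unfolding matrix_mult_transv[of "transv u f"] transv_vector
  by (simp add: transv_def outer_def vec_eq_iff distrib_left add.assoc)

lemma elem_mat_mult: "i \<noteq> j \<Longrightarrow> elem_mat i j a ** elem_mat i j b = elem_mat i j (a + b)"
proof -
  assume "i \<noteq> j"
  then have "dotp (axis j 1) (axis i b) = 0" by simp (simp add: axis_def)
  moreover have "axis i a + axis i b = axis i (a + b)" by (simp add: axis_def vec_eq_iff)
  ultimately show ?thesis unfolding elem_mat_def by (simp only: transv_mult_left)
qed

lemma elem_mat_0 [simp]: "elem_mat i j 0 = mat 1"
  by (auto simp: elem_mat_def transv_def outer_def axis_def vec_eq_iff)

lemma transv_conj:
  fixes h :: "'a::semiring_1^'n^'n"
  assumes "h' ** h = mat 1"
  shows "h ** transv u f = transv (h *v u) (f v* h') ** h"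
proof -
  have "(f v* h') v* h = f v* (h' ** h)" by (rule vector_matrix_mul_assoc)
  then show ?thesis
    using assms by (simp add: matrix_mult_transv transv_matrix_mult)
qed

lemma transv_conj':
  fixes h :: "'a::semiring_1^'n^'n"
  assumes "h' ** h = mat 1" "h ** h' = mat 1"
  shows "h ** transv u f ** h' = transv (h *v u) (f v* h')"
  unfolding transv_conj[OF assms(1)] by (simp add: matrix_mul_assoc[symmetric] assms)

lemma matrix_vector_rscale: "A *v rscale x c = rscale (A *v x) c"
  by (simp add: matrix_vector_mult_def rscale_def vec_eq_iff sum_distrib_right mult.assoc)

section \<open>Groups containing all elementary matrices\<close>

definition contains_elems :: "('a::division_ring^'n^'n) set \<Rightarrow> bool" where
  "contains_elems K \<longleftrightarrow> (\<forall>i j a. i \<noteq> j \<longrightarrow> elem_mat i j a \<in> K)"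

lemma contains_elemsD: "contains_elems K \<Longrightarrow> i \<noteq> j \<Longrightarrow> elem_mat i j a \<in> K"
  unfolding contains_elems_def by blast

text \<open>Since \<open>u $ j = 0\<close>, transvections with the row \<open>axis j 1\<close>
  multiply by adding columns, so this one is a product of elementary matrices, one for each
  entry.\<close>

lemma column_transv_mem:
  assumes K: "mat_group K" "contains_elems K" and u: "u $ j = 0"
  shows "transv u (axis j 1) \<in> K"
proof -
  have "transv (\<chi> r. if r \<in> T then u $ r else 0) (axis j 1) \<in> K" if "finite T" for T
    using that
  proof (induction T rule: finite_induct)
    case empty
    have "(\<chi> r. if r \<in> {} then u $ r else 0) = 0" by (simp add: vec_eq_iff)
    then show ?case using mat_groupD(1)[OF K(1)] by simp
  next
    case (insert r T)
    let ?v = "\<chi> r. if r \<in> T then u $ r else 0"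
    have eq: "(\<chi> s. if s \<in> insert r T then u $ s else 0) = axis r (u $ r) + ?v"
      using insert.hyps by (auto simp: vec_eq_iff axis_def)
    have "dotp (axis j 1) ?v = 0" using u by simp
    then have "transv (\<chi> s. if s \<in> insert r T then u $ s else 0) (axis j 1)
        = elem_mat r j (u $ r) ** transv ?v (axis j 1)"
      unfolding eq elem_mat_def by (rule transv_mult_left[symmetric])
    moreover have "elem_mat r j (u $ r) \<in> K"
      using contains_elemsD[OF K(2)] mat_groupD(1)[OF K(1)] u by (cases "r = j") auto
    ultimately show ?case using mat_groupD(2)[OF K(1)] insert.IH by simp
  qed
  from this[of UNIV] show ?thesis by simp
qed

text \<open>The row version of \<open>column_transv_mem\<close>; for fixed \<open>i\<close> these
  matrices form the abelian group \<open>A\<close> of Iwasawa's argument.\<close>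

lemma row_transv_mem:
  assumes K: "mat_group K" "contains_elems K" and f: "f $ i = 0"
  shows "transv (axis i 1) f \<in> K"
proof -
  have "transv (axis i 1) (\<chi> r. if r \<in> T then f $ r else 0) \<in> K" if "finite T" for T
    using that
  proof (induction T rule: finite_induct)
    case empty
    have "(\<chi> r. if r \<in> {} then f $ r else 0) = 0" by (simp add: vec_eq_iff)
    then show ?case using mat_groupD(1)[OF K(1)] by simp
  next
    case (insert r T)
    let ?v = "\<chi> r. if r \<in> T then f $ r else 0"
    have eq: "(\<chi> s. if s \<in> insert r T then f $ s else 0) = ?v + axis r (f $ r)"
      using insert.hyps by (auto simp: vec_eq_iff axis_def)
    have "dotp ?v (axis i 1) = 0" using f by simp
    then have "transv (axis i 1) (\<chi> s. if s \<in> insert r T then f $ s else 0)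
        = transv (axis i 1) ?v ** elem_mat i r (f $ r)"
      unfolding eq using transv_axis[of i 1 r "f $ r"] by (simp add: transv_mult_right[symmetric])
    moreover have "elem_mat i r (f $ r) \<in> K"
      using contains_elemsD[OF K(2)] mat_groupD(1)[OF K(1)] f by (cases "r = i") auto
    ultimately show ?case using mat_groupD(2)[OF K(1)] insert.IH by simp
  qed
  from this[of UNIV] show ?thesis by simp
qed

text \<open>First coordinate \<open>j\<close> is made nonzero, then the others are cleared. The
  clause on fixed vectors lets \<open>two_transitive\<close> place a second vector without
  disturbing the first.\<close>

lemma move_to_axis:
  fixes x :: "'a::division_ring^'n"
  assumes K: "mat_group K" "contains_elems K" and x: "x $ k \<noteq> 0"
  obtains g c where "g \<in> K" "c \<noteq> 0" "g *v x = axis j c"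
    "\<And>y. y $ k = 0 \<Longrightarrow> y $ j = 0 \<Longrightarrow> g *v y = y"
proof -
  have "\<exists>g1\<in>K. (g1 *v x) $ j \<noteq> 0 \<and> (\<forall>y. y $ k = 0 \<longrightarrow> y $ j = 0 \<longrightarrow> g1 *v y = y)"
  proof (cases "x $ j = 0")
    case True
    then have "j \<noteq> k" using x by auto
    then have "elem_mat j k 1 \<in> K" using contains_elemsD[OF K(2)] by blast
    then show ?thesis using x True by (intro bexI[of _ "elem_mat j k 1"]) (auto simp: elem_mat_vector vec_eq_iff axis_def)
  next
    case False
    then show ?thesis using mat_groupD(1)[OF K(1)] by (intro bexI[of _ "mat 1"]) auto
  qed
  then obtain g1 where g1: "g1 \<in> K" "(g1 *v x) $ j \<noteq> 0"
    "\<And>y. y $ k = 0 \<Longrightarrow> y $ j = 0 \<Longrightarrow> g1 *v y = y" by blast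
  define x1 where "x1 = g1 *v x"
  define u where "u = (\<chi> r. if r = j then 0 else - (x1 $ r * inverse (x1 $ j)))"
  have nz: "x1 $ j \<noteq> 0" using g1(2) by (simp add: x1_def)
  have g2: "transv u (axis j 1) \<in> K" by (rule column_transv_mem[OF K]) (simp add: u_def)
  have "transv u (axis j 1) *v x1 = axis j (x1 $ j)"
    unfolding transv_vector dotp_axis
    using nz by (auto simp: vec_eq_iff rscale_def u_def axis_def mult.assoc)
  then have "(transv u (axis j 1) ** g1) *v x = axis j (x1 $ j)"
    by (simp add: matrix_vector_mul_assoc[symmetric] x1_def)
  moreover have "(transv u (axis j 1) ** g1) *v y = y" if "y $ k = 0" "y $ j = 0" for y
    using g1(3)[OF that] that
    by (simp add: matrix_vector_mul_assoc[symmetric] transv_vector rscale_def vec_eq_iff)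
  ultimately show ?thesis using that nz mat_groupD(2)[OF K(1) g2 g1(1)] by blast
qed

text \<open>Once \<open>v\<close> lies on axis \<open>i\<close>, the image of \<open>w\<close> has a
  nonzero coordinate \<open>l\<close> off that axis; the element moving it to axis \<open>j\<close>
  fixes axis \<open>i\<close>, whose coordinates at \<open>l\<close> and \<open>j\<close> are
  0.\<close>

lemma two_transitive:
  fixes v w :: "'a::division_ring^'n"
  assumes K: "mat_group K" "contains_elems K" and v: "v \<noteq> 0" and w: "\<And>c. w \<noteq> rscale v c"
    and ij: "i \<noteq> j"
  obtains g c d where "g \<in> K" "c \<noteq> 0" "g *v v = axis i c" "d \<noteq> 0" "g *v w = axis j d"
proof -
  obtain k where k: "v $ k \<noteq> 0" using v by (auto simp: vec_eq_iff)
  obtain g1 c where g1: "g1 \<in> K" "c \<noteq> 0" "g1 *v v = axis i c"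
    using move_to_axis[OF K k, of i] by metis
  obtain g1' where g1': "g1' ** g1 = mat 1" using mat_groupD(3)[OF K(1) g1(1)] by blast
  have "\<exists>l. l \<noteq> i \<and> (g1 *v w) $ l \<noteq> 0"
  proof (rule ccontr)
    assume "\<not> ?thesis"
    then have "g1 *v w = axis i ((g1 *v w) $ i)" by (auto simp: vec_eq_iff axis_def)
    also have "\<dots> = rscale (axis i c) (inverse c * (g1 *v w) $ i)"
      using g1(2) by (simp add: mult.assoc[symmetric])
    also have "\<dots> = g1 *v rscale v (inverse c * (g1 *v w) $ i)"
      by (simp only: matrix_vector_rscale g1(3))
    finally have "g1' *v (g1 *v w) = g1' *v (g1 *v rscale v (inverse c * (g1 *v w) $ i))" by simp
    then have "w = rscale v (inverse c * (g1 *v w) $ i)" by (simp only: matrix_vector_mul_assoc g1' matrix_vector_mul_lid)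
    then show False using w by blast
  qed
  then obtain l where l: "l \<noteq> i" "(g1 *v w) $ l \<noteq> 0" by blast
  obtain g2 d where g2: "g2 \<in> K" "d \<noteq> 0" "g2 *v (g1 *v w) = axis j d"
    "\<And>y. y $ l = 0 \<Longrightarrow> y $ j = 0 \<Longrightarrow> g2 *v y = y"
    using move_to_axis[OF K l(2), of j] by metis
  have "g2 *v axis i c = axis i c" using l(1) ij by (intro g2(4)) (auto simp: axis_def)
  then have "(g2 ** g1) *v v = axis i c" by (simp add: matrix_vector_mul_assoc[symmetric] g1(3))
  moreover have "(g2 ** g1) *v w = axis j d" by (simp add: matrix_vector_mul_assoc[symmetric] g2(3))
  ultimately show ?thesis using that mat_groupD(2)[OF K(1) g2(1) g1(1)] g1(2) g2(2) by blast
qed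

lemma exists_distinct_indices:
  assumes "CARD('n) \<ge> 2"
  obtains i j :: 'n where "i \<noteq> j"
  using assms by (metis (full_types) UNIV_I card_2_iff' card_le_Suc_iff numeral_2_eq_2 insertCI)

lemma mat_if_preserves_lines:
  fixes h :: "'a::division_ring^'n^'n"
  assumes n: "CARD('n) \<ge> 2" and h: "\<And>v. \<exists>c. h *v v = rscale v c"
  obtains \<alpha> where "\<alpha> \<in> center_of UNIV" "h = mat \<alpha>"
proof -
  have "\<forall>i. \<exists>c. h *v axis i 1 = axis i c"
    using h[of "axis _ 1"] by simp
  then have "\<exists>c. \<forall>i. h *v axis i 1 = axis i (c i)" by (rule choice)
  then obtain c where c: "\<And>i. h *v axis i 1 = axis i (c i)" by blast
  have ca: "h *v axis i a = axis i (c i * a)" for i a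
    using matrix_vector_rscale[of h "axis i 1" a] c[of i] by simp
  have key: "c j * a = a * c i" if ij: "i \<noteq> j" for i j a
  proof -
    obtain d where d: "h *v (axis i 1 + axis j a) = rscale (axis i 1 + axis j a) d" using h by blast
    have "axis i (c i) + axis j (c j * a) = rscale (axis i 1 + axis j a) d"
      using d by (simp add: matrix_vector_right_distrib ca)
    then have e: "(axis i (c i) + axis j (c j * a)) $ r = rscale (axis i 1 + axis j a) d $ r" for r by simp
    have "c i = d" using e[of i] ij by (simp add: rscale_def axis_def)
    moreover have "c j * a = a * d" using e[of j] ij by (simp add: rscale_def axis_def)
    ultimately show ?thesis by simp
  qed
  have eq: "c i = c j" for i j using key[of i j 1] by (cases "i = j") auto
  obtain i j :: 'n where ij: "i \<noteq> j"
    by (rule exists_distinct_indices[OF n])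
  have "c i \<in> center_of UNIV"
    unfolding center_of_UNIV_iff using key[OF ij] eq[of i j] by simp
  moreover have "h = mat (c i)"
  proof -
    have "h $ r $ s = mat (c i) $ r $ s" for r s
    proof -
      have "h $ r $ s = (h *v axis s 1) $ r"
        by (simp add: matrix_vector_mult_def axis_def if_distrib cong: if_cong)
      then show ?thesis using c[of s] eq[of s i] by (simp add: axis_def mat_def)
    qed
    then show ?thesis by (simp add: vec_eq_iff)
  qed
  ultimately show ?thesis using that by blast
qed

text \<open>Comparing \<open>u\<close> with \<open>u + 1\<close> puts
  \<open>u * b + b * u + b\<close> in \<open>W\<close>; the first two terms are additive in
  \<open>u\<close>, so combining \<open>u\<close>, \<open>v\<close> and \<open>u + v\<close> leaves
  \<open>b\<close>.\<close>

lemma additive_span_minus_conj: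
  fixes W :: "'a::division_ring set"
  assumes inf: "infinite (UNIV :: 'a set)" and diff: "\<And>x y. x \<in> W \<Longrightarrow> y \<in> W \<Longrightarrow> x - y \<in> W"
    and W: "\<And>u b. u \<noteq> 0 \<Longrightarrow> b - u * b * u \<in> W"
  shows "b \<in> W"
proof -
  have s: "u * b + b * u + b \<in> W" if "u \<noteq> 0" "u \<noteq> - 1" for u
  proof -
    have "u + 1 \<noteq> 0" using that(2) by (metis add.inverse_inverse eq_neg_iff_add_eq_0)
    then have "(b - u * b * u) - (b - (u + 1) * b * (u + 1)) \<in> W" using that(1) by (intro diff W)
    moreover have "(b - u * b * u) - (b - (u + 1) * b * (u + 1)) = u * b + b * u + b"
      by (simp add: algebra_simps)
    ultimately show ?thesis by simp
  qed
  obtain u :: 'a where u: "u \<notin> {0, - 1}" using ex_new_if_finite[OF inf, of "{0, - 1}"] by auto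
  \<comment> \<open>The excluded values keep both \<open>v\<close> and \<open>u + v\<close> away
    from 0 and -1.\<close>
  obtain v where v: "v \<notin> {0, - 1, - u, - 1 - u}"
    using ex_new_if_finite[OF inf, of "{0, - 1, - u, - 1 - u}"] by auto
  have "u + v \<noteq> 0" "u + v \<noteq> - 1" using v by (auto simp: add_eq_0_iff algebra_simps)
  then have "(u * b + b * u + b) - (((u + v) * b + b * (u + v) + b) - (v * b + b * v + b)) \<in> W"
    using u v by (intro diff s) auto
  then show ?thesis by (simp add: algebra_simps)
qed

section \<open>Iwasawa's argument\<close>

text \<open>\<open>h\<close> moves the line of \<open>v\<close> to another line; conjugating by an
  element of \<open>K\<close> that carries these two lines to the axes \<open>i\<close> and
  \<open>j\<close> stays in \<open>H\<close>.\<close>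

lemma normal_transitive_on_axes:
  fixes H :: "('a::division_ring^'n^'n) set"
  assumes HK: "mat_normal H K" "contains_elems K"
    and h: "h \<in> H" "\<And>c. h *v v \<noteq> rscale v c" and ij: "i \<noteq> j"
  obtains g c where "g \<in> H" "c \<noteq> 0" "g *v axis i 1 = axis j c"
proof -
  note K = mat_normalD(2)[OF HK(1)]
  have "v \<noteq> 0"
  proof
    assume "v = 0"
    then have "h *v v = rscale v 0" by simp
    then show False using h(2) by blast
  qed
  then obtain g c d where g: "g \<in> K" "c \<noteq> 0" "g *v v = axis i c" "d \<noteq> 0" "g *v (h *v v) = axis j d"
    using two_transitive[OF K HK(2) _ h(2) ij] by metis
  obtain g' where g': "g' \<in> K" "g ** g' = mat 1" "g' ** g = mat 1"
    using mat_groupD(3)[OF K g(1)] by blast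
  have "g' *v axis i c = v"
    using g(3)[symmetric] by (simp add: matrix_vector_mul_assoc g')
  then have "(g ** h ** g') *v axis i c = axis j d"
    using g(5) by (simp add: matrix_vector_mul_assoc[symmetric])
  then have "rscale ((g ** h ** g') *v axis i c) (inverse c) = axis j (d * inverse c)"
    by simp
  then have "(g ** h ** g') *v axis i 1 = axis j (d * inverse c)"
    using g(2) by (simp add: matrix_vector_rscale[symmetric])
  moreover have "g ** h ** g' \<in> H"
    using mat_normalD(4)[OF HK(1) g(1) g'(1) h(1) g'(2,3)] .
  moreover have "d * inverse c \<noteq> 0" using g(2,4) by simp
  ultimately show ?thesis using that by blast
qed

text \<open>Modulo \<open>H\<close> the two factors are \<open>a\<close> and \<open>b\<close>, which
  commute; so their commutator \<open>k\<close> lies in \<open>H\<close>. No quotient group is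
  formed.\<close>

lemma mat_normal_commutator:
  fixes H :: "('a::division_ring^'n^'n) set"
  assumes HK: "mat_normal H K" and ab: "a \<in> K" "b \<in> K" "a ** b = b ** a"
    and hg: "h \<in> H" "g \<in> H"
  obtains k where "k \<in> H" "(h ** a) ** (g ** b) = k ** ((g ** b) ** (h ** a))"
proof -
  note H = mat_normalD(1)[OF HK] and K = mat_normalD(2)[OF HK]
  obtain a' where a': "a' \<in> K" "a ** a' = mat 1" "a' ** a = mat 1" using mat_groupD(3)[OF K ab(1)] by blast
  obtain b' where b': "b' \<in> K" "b ** b' = mat 1" "b' ** b = mat 1" using mat_groupD(3)[OF K ab(2)] by blast
  \<comment> \<open>Chosen so that \<open>x ** (a ** b)\<close> and \<open>y ** (b ** a)\<close> are
    the two products to be compared; then \<open>k\<close> is \<open>x ** y'\<close>.\<close>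
  define x where "x = h ** (a ** g ** a')"
  define y where "y = g ** (b ** h ** b')"
  have x: "x \<in> H" unfolding x_def
    using mat_groupD(2)[OF H hg(1) mat_normalD(4)[OF HK ab(1) a'(1) hg(2) a'(2,3)]] .
  have y: "y \<in> H" unfolding y_def
    using mat_groupD(2)[OF H hg(2) mat_normalD(4)[OF HK ab(2) b'(1) hg(1) b'(2,3)]] .
  obtain y' where y': "y' \<in> H" "y' ** y = mat 1" using mat_groupD(3)[OF H y] by blast
  have "x ** (a ** b) = h ** a ** g ** (a' ** a) ** b"
    by (simp add: x_def matrix_mul_assoc)
  then have xab: "x ** (a ** b) = (h ** a) ** (g ** b)"
    using a'(3) by (simp add: matrix_mul_assoc)
  have "y ** (b ** a) = g ** b ** h ** (b' ** b) ** a"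
    by (simp add: y_def matrix_mul_assoc)
  then have "y ** (b ** a) = (g ** b) ** (h ** a)"
    using b'(3) by (simp add: matrix_mul_assoc)
  then have "x ** y' ** ((g ** b) ** (h ** a)) = x ** y' ** (y ** (b ** a))" by simp
  also have "\<dots> = x ** (y' ** y) ** (b ** a)" by (simp add: matrix_mul_assoc)
  also have "\<dots> = (h ** a) ** (g ** b)" using y' xab ab(3) by simp
  finally show ?thesis using that mat_groupD(2)[OF H x y'(1)] by metis
qed

text \<open>The elementary matrix is a transvection along axis \<open>i\<close>. Some
  \<open>g\<close> in \<open>H\<close> sends axis \<open>l\<close> to axis \<open>i\<close>, and a
  conjugate \<open>g t g'\<close> equals \<open>g (t g' t') t\<close>, which lies in
  \<open>H t\<close> by normality.\<close>

lemma elem_mat_mem_normal_mult_transvs: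
  fixes H :: "('a::division_ring^'n^'n) set"
  assumes HK: "mat_normal H K" "contains_elems K"
    and h: "h \<in> H" "\<And>c. h *v v \<noteq> rscale v c" and ij: "i \<noteq> j"
  obtains g f where "g \<in> H" "f $ l = 0" "elem_mat i j a = g ** transv (axis l 1) f"
proof (cases "i = l")
  case True
  have "elem_mat i j a = mat 1 ** transv (axis l 1) (axis j a)"
    using transv_axis[of i 1 j a] True by simp
  then show ?thesis
    using that[of "mat 1" "axis j a"] mat_groupD(1)[OF mat_normalD(1)[OF HK(1)]] True ij
    by (simp add: axis_def)
next
  case False
  note H = mat_normalD(1)[OF HK(1)] and K = mat_normalD(2)[OF HK(1)]
  obtain g c where g: "g \<in> H" "c \<noteq> 0" "g *v axis l 1 = axis i c"
    using normal_transitive_on_axes[OF HK h, of l i] False by metis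
  obtain g' where g': "g' \<in> H" "g ** g' = mat 1" "g' ** g = mat 1"
    using mat_groupD(3)[OF H g(1)] by blast
  \<comment> \<open>The row is pulled back through \<open>g\<close>, so that conjugation by
    \<open>g\<close> restores it; \<open>inverse c\<close> undoes the factor that \<open>g\<close>
    puts on axis \<open>i\<close>.\<close>
  define f where "f = axis j (inverse c * a) v* g"
  have "f $ l = dotp (axis j (inverse c * a)) (g *v axis l 1)"
  proof -
    have "(g *v axis l 1) $ r = g $ r $ l" for r
      by (simp add: matrix_vector_mult_def axis_def if_distrib cong: if_cong)
    then show ?thesis by (simp only: f_def vector_matrix_mult_def dotp_def vec_lambda_beta)
  qed
  then have f: "f $ l = 0" using ij g(3) by simp (simp add: axis_def)
  let ?t = "transv (axis l 1) f"
  have t: "?t \<in> K" by (rule row_transv_mem[OF K HK(2) f])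
  obtain t' where t': "t' \<in> K" "?t ** t' = mat 1" "t' ** ?t = mat 1"
    using mat_groupD(3)[OF K t] by blast
  have "f v* g' = axis j (inverse c * a)"
    by (simp add: f_def vector_matrix_mul_assoc g'(2))
  then have "g ** ?t ** g' = transv (axis i c) (axis j (inverse c * a))"
    using transv_conj'[OF g'(3,2)] g(3) by simp
  also have "\<dots> = elem_mat i j a" using g(2) by (simp add: transv_axis mult.assoc[symmetric])
  finally have e: "elem_mat i j a = g ** ?t ** g'" ..
  have "g ** (?t ** g' ** t') ** ?t = g ** ?t ** g' ** (t' ** ?t)"
    by (simp add: matrix_mul_assoc)
  then have "elem_mat i j a = g ** (?t ** g' ** t') ** ?t" using e t'(3) by simp
  moreover have "g ** (?t ** g' ** t') \<in> H"
    using mat_groupD(2)[OF H g(1) mat_normalD(4)[OF HK(1) t t'(1) g'(1) t'(2,3)]] .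
  ultimately show ?thesis using that f by blast
qed

text \<open>For nonzero \<open>a\<close> and distinct indices, the Weyl element with block
  \<open>(0, a; -1/a, 0)\<close> in rows and columns \<open>i\<close>, \<open>j\<close>; it
  interchanges the two axes up to scalars.\<close>

definition weyl :: "'n \<Rightarrow> 'n \<Rightarrow> 'a::division_ring \<Rightarrow> 'a^'n^'n" where
  "weyl i j a = elem_mat i j a ** elem_mat j i (- inverse a) ** elem_mat i j a"

lemma weyl_inverse:
  fixes a :: "'a::division_ring"
  assumes "i \<noteq> j"
  shows "weyl i j a ** weyl i j (- a) = (mat 1 :: 'a^'n^'n)"
proof -
  have "weyl i j a ** weyl i j (- a) =
    elem_mat i j a ** elem_mat j i (- inverse a) ** (elem_mat i j a ** elem_mat i j (- a)) ** elem_mat j i (inverse a) ** elem_mat i j (- a)"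
    by (simp add: weyl_def matrix_mul_assoc)
  also have "\<dots> = elem_mat i j a ** elem_mat j i (- inverse a) ** elem_mat j i (inverse a) ** elem_mat i j (- a)"
    using assms by (simp add: elem_mat_mult)
  also have "\<dots> = elem_mat i j a ** (elem_mat j i (- inverse a) ** elem_mat j i (inverse a)) ** elem_mat i j (- a)"
    by (simp add: matrix_mul_assoc)
  also have "\<dots> = mat 1" using assms by (simp add: elem_mat_mult)
  finally show ?thesis .
qed

lemma weyl_conj_elem:
  fixes a b :: "'a::division_ring"
  assumes ij: "i \<noteq> j" and a: "a \<noteq> 0"
  shows "weyl i j a ** elem_mat i j b = elem_mat j i (- (inverse a * b * inverse a)) ** (weyl i j a :: 'a^'n^'n)"
proof -
  have inv: "weyl i j (- a) ** weyl i j a = (mat 1 :: 'a^'n^'n)" using weyl_inverse[OF ij, of "- a"] by simp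
  have 1: "weyl i j a *v axis i b = axis j (- (inverse a * b))"
    using ij a unfolding weyl_def matrix_vector_mul_assoc[symmetric] elem_mat_vector
    by (auto simp: vec_eq_iff axis_def mult.assoc[symmetric])
  have 2: "axis j 1 v* weyl i j (- a) = axis i (inverse a)"
    using ij a unfolding weyl_def vector_matrix_mul_assoc[symmetric] vector_elem_mat
    by (auto simp: vec_eq_iff axis_def)
  have "weyl i j a ** elem_mat i j b = transv (axis j (- (inverse a * b))) (axis i (inverse a)) ** weyl i j a"
    unfolding elem_mat_def[of i j b] transv_conj[OF inv] 1 2 ..
  then show ?thesis by (simp add: transv_axis)
qed

text \<open>\<open>Q\<close>, the set \<open>H A\<close>, contains all products of elementary
  matrices, and its commutators lie in \<open>H\<close>. Commuting Weyl elements with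
  \<open>elem_mat i j b\<close> ties this matrix modulo \<open>H\<close> to matrices at
  \<open>(j, i)\<close>; eliminating it from two such relations puts
  \<open>elem_mat j i (b - u * b * u)\<close> in \<open>H\<close>, and these parameters generate
  \<open>D\<close> additively.\<close>

theorem normal_contains_elems:
  fixes H :: "('a::division_ring^'n^'n) set"
  assumes inf: "infinite (UNIV :: 'a set)"
    and HK: "mat_normal H K" "contains_elems K"
    and h: "h \<in> H" "\<And>c. h *v v \<noteq> rscale v c"
  shows "contains_elems H"
  unfolding contains_elems_def
proof (intro allI impI)
  \<comment> \<open>The goal is taken at position \<open>(j, i)\<close>, to which conjugation by
    \<open>weyl i j a\<close> sends position \<open>(i, j)\<close>.\<close>
  fix j i :: 'n and b0 :: 'a assume ji: "j \<noteq> i"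
  then have ij: "i \<noteq> j" by simp
  note H = mat_normalD(1)[OF HK(1)] and K = mat_normalD(2)[OF HK(1)]
  define A where "A = {transv (axis i 1) f | f :: 'a^'n. f $ i = 0}"
  define Q where "Q = {g ** t | g t. g \<in> H \<and> t \<in> A}"
  have AK: "t \<in> K" if "t \<in> A" for t
    using that row_transv_mem[OF K HK(2)] unfolding A_def by blast
  have A_mult: "s ** t \<in> A \<and> s ** t = t ** s" if st: "s \<in> A" "t \<in> A" for s t
  proof -
    obtain f f' where f: "s = transv (axis i 1) f" "f $ i = 0" "t = transv (axis i 1) f'" "f' $ i = 0"
      using st unfolding A_def by blast
    have "s ** t = transv (axis i 1) (f + f')" "t ** s = transv (axis i 1) (f' + f)"
      using f by (simp_all add: transv_mult_right)
    moreover have "(f + f') $ i = 0" using f by simp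
    ultimately show ?thesis unfolding A_def by (auto simp: add.commute)
  qed
  have Q_elem_mat: "elem_mat r s a \<in> Q" if rs: "r \<noteq> s" for r s a
  proof -
    obtain g f where "g \<in> H" "f $ i = 0" "elem_mat r s a = g ** transv (axis i 1) f"
      by (rule elem_mat_mem_normal_mult_transvs[OF HK h rs])
    then show ?thesis unfolding Q_def A_def by blast
  qed
  have Q_mult: "x ** y \<in> Q" if xy: "x \<in> Q" "y \<in> Q" for x y
  proof -
    obtain g s g' t where g: "x = g ** s" "g \<in> H" "s \<in> A" "y = g' ** t" "g' \<in> H" "t \<in> A"
      using xy unfolding Q_def by blast
    obtain s' where s': "s' \<in> K" "s ** s' = mat 1" "s' ** s = mat 1"
      using mat_groupD(3)[OF K AK[OF g(3)]] by blast
    \<comment> \<open>Moving \<open>s\<close> past \<open>g'\<close> by conjugation restores the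
      form of an element of \<open>H A\<close>.\<close>
    have "g ** (s ** g' ** s') ** (s ** t) = g ** s ** g' ** (s' ** s) ** t"
      by (simp add: matrix_mul_assoc)
    then have "x ** y = g ** (s ** g' ** s') ** (s ** t)" using g s' by (simp add: matrix_mul_assoc)
    moreover have "g ** (s ** g' ** s') \<in> H"
      using mat_groupD(2)[OF H g(2) mat_normalD(4)[OF HK(1) AK[OF g(3)] s'(1) g(5) s'(2,3)]] .
    moreover have "s ** t \<in> A" using A_mult[OF g(3,6)] by blast
    ultimately show ?thesis unfolding Q_def by blast
  qed
  have Q_comm: "\<exists>k\<in>H. x ** y = k ** (y ** x)" if xy: "x \<in> Q" "y \<in> Q" for x y
  proof -
    obtain g s g' t where g: "x = g ** s" "g \<in> H" "s \<in> A" "y = g' ** t" "g' \<in> H" "t \<in> A"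
      using xy unfolding Q_def by blast
    show ?thesis unfolding g(1,4)
      using mat_normal_commutator[OF HK(1) AK[OF g(3)] AK[OF g(6)] _ g(2,5)] A_mult[OF g(3,6)] by metis
  qed
  have conj: "\<exists>k\<in>H. elem_mat j i (- (inverse a * b * inverse a)) = k ** elem_mat i j b" if a: "a \<noteq> 0" for a b
  proof -
    have "weyl i j a \<in> Q" unfolding weyl_def by (intro Q_mult Q_elem_mat ij ji)
    then obtain k where k: "k \<in> H" "weyl i j a ** elem_mat i j b = k ** (elem_mat i j b ** weyl i j a)"
      using Q_comm[OF _ Q_elem_mat[OF ij]] by blast
    have "elem_mat j i (- (inverse a * b * inverse a)) ** weyl i j a ** weyl i j (- a)
        = k ** (elem_mat i j b ** weyl i j a) ** weyl i j (- a)"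
      using k(2) weyl_conj_elem[OF ij a, of b] by simp
    then have "elem_mat j i (- (inverse a * b * inverse a)) = k ** elem_mat i j b"
      using weyl_inverse[OF ij, of a] by (simp add: matrix_mul_assoc[symmetric])
    then show ?thesis using k(1) by blast
  qed
  let ?W = "{c. elem_mat j i c \<in> H}"
  have "b0 \<in> ?W"
  proof (rule additive_span_minus_conj[OF inf])
    fix x y assume xy: "x \<in> ?W" "y \<in> ?W"
    have "elem_mat j i y ** elem_mat j i (- y) = mat 1" using elem_mat_mult[OF ji, of y "- y"] by simp
    then have "elem_mat j i (- y) \<in> H" using mat_group_inverse[OF H] xy by blast
    then have "elem_mat j i x ** elem_mat j i (- y) \<in> H" using mat_groupD(2)[OF H] xy by blast
    then show "x - y \<in> ?W" using elem_mat_mult[OF ji, of x "- y"] by simp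
  next
    fix u b :: 'a assume u: "u \<noteq> 0"
    obtain k where k: "k \<in> H" "elem_mat j i (- (u * b * u)) = k ** elem_mat i j b"
      using conj[of "inverse u" b] u by auto
    \<comment> \<open>The relation for \<open>a = 1\<close> serves to eliminate
      \<open>elem_mat i j b\<close> from the one for \<open>inverse u\<close>.\<close>
    obtain l where l: "l \<in> H" "elem_mat j i (- b) = l ** elem_mat i j b"
      using conj[of 1 b] by auto
    obtain l' where l': "l' \<in> H" "l' ** l = mat 1" using mat_groupD(3)[OF H l(1)] by blast
    have "l' ** elem_mat j i (- b) = elem_mat i j b" using l l' by (simp add: matrix_mul_assoc)
    then have "elem_mat j i (- (u * b * u)) ** elem_mat j i b = k ** (l' ** elem_mat j i (- b)) ** elem_mat j i b"
      using k by simp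
    also have "\<dots> = k ** l' ** (elem_mat j i (- b) ** elem_mat j i b)" by (simp add: matrix_mul_assoc)
    also have "\<dots> = k ** l'" using elem_mat_mult[OF ji, of "- b" b] by simp
    finally have "elem_mat j i (- (u * b * u) + b) = k ** l'" using elem_mat_mult[OF ji] by metis
    then show "b - u * b * u \<in> ?W" using mat_groupD(2)[OF H k(1) l'(1)] by simp
  qed
  then show "elem_mat j i b0 \<in> H" by simp
qed

section \<open>Subnormal subgroups of \<open>GL\<close> and finite generation\<close>

lemma group_GL: "group (GL :: ('a::division_ring^'n^'n) monoid)"
proof (rule groupI)
  fix x y z :: "'a^'n^'n"
  show "x \<otimes>\<^bsub>GL\<^esub> y \<in> carrier GL" if "x \<in> carrier GL" "y \<in> carrier GL"
    using that by (simp add: GL_def invertible_mult)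
  show "x \<otimes>\<^bsub>GL\<^esub> y \<otimes>\<^bsub>GL\<^esub> z = x \<otimes>\<^bsub>GL\<^esub> (y \<otimes>\<^bsub>GL\<^esub> z)"
    by (simp add: GL_def matrix_mul_assoc)
  show "\<one>\<^bsub>GL\<^esub> \<otimes>\<^bsub>GL\<^esub> x = x" by (simp add: GL_def)
  show "\<exists>y\<in>carrier GL. y \<otimes>\<^bsub>GL\<^esub> x = \<one>\<^bsub>GL\<^esub>" if "x \<in> carrier GL"
    using that by (auto simp: GL_def invertible_def)
  show "\<one>\<^bsub>GL\<^esub> \<in> carrier (GL :: ('a^'n^'n) monoid)" by (auto simp: GL_def invertible_def)
qed

lemma mat_group_subgroup:
  fixes H :: "('a::division_ring^'n^'n) set"
  assumes "subgroup H GL"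
  shows "mat_group H"
  unfolding mat_group_def
proof (intro conjI ballI)
  interpret GL: group "GL :: ('a^'n^'n) monoid" by (rule group_GL)
  show "mat 1 \<in> H" using subgroup.one_closed[OF assms] by (simp add: GL_def)
  show "x ** y \<in> H" if "x \<in> H" "y \<in> H" for x y
    using subgroup.m_closed[OF assms that] by (simp add: GL_def)
  show "\<exists>y\<in>H. x ** y = mat 1 \<and> y ** x = mat 1" if "x \<in> H" for x
    using subgroup.m_inv_closed[OF assms that] GL.r_inv[of x] GL.l_inv[of x]
      subgroup.mem_carrier[OF assms that]
    by (intro bexI[of _ "inv\<^bsub>GL\<^esub> x"]) (auto simp: GL_def)
qed

lemma mat_normal_normal:
  fixes H K :: "('a::division_ring^'n^'n) set"
  assumes K: "subgroup K GL" and H: "H \<lhd> (GL\<lparr>carrier := K\<rparr>)"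
  shows "subgroup H GL" "mat_normal H K"
proof -
  interpret GL: group "GL :: ('a^'n^'n) monoid" by (rule group_GL)
  have HK: "subgroup H (GL\<lparr>carrier := K\<rparr>)" using normal_imp_subgroup[OF H] .
  show HG: "subgroup H GL" using GL.incl_subgroup[OF K HK] .
  have sub: "H \<subseteq> K" using subgroup.subset[OF HK] by simp
  have "k ** h ** k' \<in> H"
    if k: "k \<in> K" "k' \<in> K" "h \<in> H" "k ** k' = mat 1" "k' ** k = mat 1" for k k' h
  proof -
    have gK: "group (GL\<lparr>carrier := K\<rparr>)" using GL.subgroup_imp_group[OF K] .
    have "inv\<^bsub>GL\<lparr>carrier := K\<rparr>\<^esub> k = k'"
      using k by (intro group.inv_equality[OF gK]) (auto simp: GL_def)
    then show ?thesis
      using normal.inv_op_closed2[OF H, of k h] k by (simp add: GL_def)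
  qed
  then show "mat_normal H K"
    unfolding mat_normal_def using mat_group_subgroup[OF K] mat_group_subgroup[OF HG] sub by blast
qed

lemma contains_elems_GL: "contains_elems (carrier (GL :: ('a::division_ring^'n^'n) monoid))"
  unfolding contains_elems_def
proof (intro allI impI)
  fix i j :: 'n and a :: 'a assume ij: "i \<noteq> j"
  have "elem_mat i j a ** elem_mat i j (- a) = mat 1" "elem_mat i j (- a) ** elem_mat i j a = mat 1"
    using elem_mat_mult[OF ij, of a "- a"] elem_mat_mult[OF ij, of "- a" a] by simp_all
  then show "elem_mat i j a \<in> carrier GL" by (auto simp: GL_def invertible_def)
qed

text \<open>The subgroup property is carried along because each normality step needs it for
  \<open>K\<close>. An \<open>h\<close> in \<open>H\<close> that moves a line also lies in
  \<open>K\<close>, so the induction hypothesis applies to \<open>K\<close>.\<close>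

theorem subnormal_contains_elems:
  fixes N :: "('a::division_ring^'n^'n) set"
  assumes inf: "infinite (UNIV :: 'a set)" and N: "subnormal GL N"
  shows "subgroup N GL \<and> ((\<exists>h\<in>N. \<exists>v. \<forall>c. h *v v \<noteq> rscale v c) \<longrightarrow> contains_elems N)"
  using N
proof induction
  case top
  interpret GL: group "GL :: ('a^'n^'n) monoid" by (rule group_GL)
  show ?case using GL.subgroup_self contains_elems_GL by blast
next
  case (step K H)
  note HK = mat_normal_normal[OF conjunct1[OF step.IH] step.hyps(2)]
  have "contains_elems H" if h: "h \<in> H" "\<forall>c. h *v v \<noteq> rscale v c" for h v
  proof -
    have "h \<in> K" using mat_normalD(3)[OF HK(2) h(1)] .
    then have "contains_elems K" using step.IH h(2) by blast
    then show ?thesis using normal_contains_elems[OF inf HK(2) _ h(1)] h(2) by blast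
  qed
  then show ?case using HK(1) by blast
qed

text \<open>Entries of the inverses of generators are adjoined too, since inverting a matrix may
  leave the ring generated by its entries.\<close>

lemma generate_GL_entries:
  fixes S :: "('a::division_ring^'n^'n) set"
  assumes "x \<in> generate GL S"
  shows "x $ i $ j \<in> subring_gen (\<Union>A \<in> S \<union> m_inv GL ` S. range (\<lambda>(i, j). A $ i $ j))"
    (is "_ \<in> ?R")
  using assms
proof (induction arbitrary: i j)
  note R = subring_setD[OF subring_set_subring_gen]
  case one
  have "(mat 1 :: 'a^'n^'n) $ i $ j \<in> ?R" by (simp add: mat_def R)
  then show ?case by (simp add: GL_def)
next
  case (incl h)
  then show ?case by (intro subring_gen.base UN_I[of h] range_eqI[of _ _ "(i, j)"]) auto
next
  case (inv h)
  then show ?case by (intro subring_gen.base UN_I[of "inv\<^bsub>GL\<^esub> h"] range_eqI[of _ _ "(i, j)"]) auto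
next
  case (eng x y)
  have "(\<Sum>k\<in>UNIV. x $ i $ k * y $ k $ j) \<in> ?R"
    using eng.IH by (intro subring_set_sum[OF subring_set_subring_gen] subring_gen.mult)
  then show ?case by (simp add: GL_def matrix_matrix_mult_def)
qed

lemma finite_UNIV_vec:
  assumes "finite (UNIV :: 'b set)"
  shows "finite (UNIV :: ('b^'n) set)"
proof -
  have "finite (UNIV \<rightarrow>\<^sub>E UNIV :: ('n \<Rightarrow> 'b) set)" using assms by (intro finite_PiE) auto
  then have "finite (UNIV :: ('n \<Rightarrow> 'b) set)" by simp
  moreover have "surj (vec_lambda :: ('n \<Rightarrow> 'b) \<Rightarrow> 'b^'n)"
    by (rule surjI[of _ vec_nth]) simp
  ultimately show ?thesis by (metis finite_imageI)
qed

text \<open>Brings generation as a ring into the form to which weak local finiteness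
  applies.\<close>

lemma gen_division_subring_UNIV:
  assumes "subring_gen S = UNIV"
  shows "gen_division_subring S = UNIV"
proof -
  have "UNIV \<subseteq> K" if "division_subring K" "S \<subseteq> K" for K
    using subring_gen_least[OF division_subring_subring_set[OF that(1)] that(2)] assms by simp
  then show ?thesis unfolding gen_division_subring_def by blast
qed

theorem theorem5p7:
  fixes N :: "('a::division_ring ^'n^'n) set"
  assumes "weakly_locally_finite TYPE('a)"
    and "CARD('n) \<ge> 2"
    and "subnormal GL N"
    and "infinite N"
    and "\<exists>S. finite S \<and> S \<subseteq> carrier GL \<and> N = generate GL S"
  shows "N \<subseteq> {mat \<alpha> | \<alpha>. \<alpha> \<in> center_of (UNIV::'a set) \<and> \<alpha> \<noteq> 0}"
proof (cases "\<exists>h\<in>N. \<exists>v. \<forall>c. h *v v \<noteq> rscale v c")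
  case False
  show ?thesis
  proof
    fix h assume h: "h \<in> N"
    then have "\<And>v. \<exists>c. h *v v = rscale v c" using False by blast
    then obtain \<alpha> where \<alpha>: "\<alpha> \<in> center_of UNIV" "h = mat \<alpha>"
      using mat_if_preserves_lines[OF assms(2)] by metis
    obtain S where "S \<subseteq> carrier GL" "N = generate GL S" using assms(5) by blast
    then have "N \<subseteq> carrier GL" using group.generate_incl[OF group_GL] by blast
    then have "invertible h" using h by (auto simp: GL_def)
    then obtain h' where h': "h ** h' = mat 1" by (auto simp: invertible_def)
    \<comment> \<open>A diagonal entry of the identity excludes \<open>\<alpha> = 0\<close>.\<close>
    have "(h ** h') $ i $ i = 1" for i unfolding h' by (simp add: mat_def)
    then have "\<alpha> \<noteq> 0" using \<alpha> by (auto simp: matrix_matrix_mult_def)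
    then show "h \<in> {mat \<alpha> | \<alpha>. \<alpha> \<in> center_of (UNIV::'a set) \<and> \<alpha> \<noteq> 0}" using \<alpha> by blast
  qed
next
  case True
  have inf: "infinite (UNIV :: 'a set)"
  proof
    assume "finite (UNIV :: 'a set)"
    then have "finite (UNIV :: ('a^'n^'n) set)" by (intro finite_UNIV_vec)
    then have "finite N" by (rule finite_subset[OF subset_UNIV])
    then show False using assms(4) by contradiction
  qed
  have elems: "contains_elems N" using subnormal_contains_elems[OF inf assms(3)] True by blast
  obtain S where S: "finite S" "N = generate GL S" using assms(5) by blast
  \<comment> \<open>These finitely many entries generate \<open>D\<close> as a ring, because
    \<open>elem_mat i j a\<close> lies in \<open>N\<close> and its entry at \<open>(i, j)\<close> is
    \<open>a\<close>.\<close>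
  define T where "T = (\<Union>A \<in> S \<union> m_inv GL ` S. range (\<lambda>(i, j). A $ i $ j))"
  have T: "finite T" unfolding T_def using S(1) by auto
  obtain i j :: 'n where ij: "i \<noteq> j"
    by (rule exists_distinct_indices[OF assms(2)])
  have "a \<in> subring_gen T" for a
  proof -
    have "elem_mat i j a \<in> generate GL S" using contains_elemsD[OF elems ij] S(2) by simp
    then have "elem_mat i j a $ i $ j \<in> subring_gen T" unfolding T_def by (rule generate_GL_entries)
    then show ?thesis using ij by (simp add: elem_mat_def transv_def outer_def mat_def)
  qed
  then have gen: "subring_gen T = UNIV" by (rule UNIV_eq_I[symmetric])
  have "fin_dim_over UNIV (center_of (UNIV :: 'a set))"
    using assms(1) T gen_division_subring_UNIV[OF gen] unfolding weakly_locally_finite_def by metis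
  then have "finite (UNIV :: 'a set)"
    by (rule finitely_generated_ring_center_fin_dim_finite[OF T gen])
  then show ?thesis using inf by contradiction
qed

end
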